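(* The skew field of fractions of $\mathcal{D}$ is $\Bbbk$-isomorphic to the Weyl skew field $\mathscr{D}_{2,2}(\Bbbk)$.
   Context: $\Bbbk$ is an algebraically closed field of characteristic $0$. The algebra $\mathcal{D}$ (the double of the Jordan plane) is the associative unital $\Bbbk$-algebra with generators $u, v, \zeta, g^{\pm1}, x, y$ and relations $g^{\pm1}g^{\mp1}=1$, $\zeta g=g\zeta$, $gx=xg$, $gy=yg+xg$, $\zeta y=y\zeta+y$, $\zeta x=x\zeta+x$, $ug=gu$, $vg=gv+gu$, $v\zeta=\zeta v+v$, $u\zeta=\zeta u+u$, $yx=xy-\frac12x^2$, $vu=uv-\frac12u^2$, $ux=xu$, $vx=xv+(1-g)+xu$, $uy=yu+(1-g)$, $vy=yv-g\zeta+yu$. It is a noetherian domain, so it has a skew field of fractions. For a field $K$, $A_n(K)$ is the $n$-th Weyl algebra over $K$ (generated over $K$ by $q_1,\dots,q_n,p_1,\dots,p_n$ with $p_iq_j-q_jp_i=\delta_{ij}$, the $q_i$ commuting with each other and the $p_i$ commuting with each other). The Weyl skew field $\mathscr{D}_{n,s}(\Bbbk)$ is the skew field of fractions of $A_n(K)$, where $K=\Bbbk(z_1,\dots,z_s)$ is a purely transcendental extension of $\Bbbk$ of degree $s$. *)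

theory Defs
  imports
    "HOL-Algebra.Algebraic_Closure_Type"
    "HOL-Library.Poly_Mapping"
    "HOL-Library.Numeral_Type"
begin

section \<open>Algebras given by generators and relations\<close>

text \<open>
  The free monoid on \<open>'x\<close>, written additively (although it is not commutative) so that
  \<open>'x word \<Rightarrow>\<^sub>0 'k\<close>, with the convolution product of \<^theory>\<open>HOL-Library.Poly_Mapping\<close>, is the
  free associative unital algebra on \<open>'x\<close> over \<open>'k\<close>.
\<close>

datatype 'x word = Word (letters: "'x list")

instantiation word :: (type) monoid_add
begin

definition zero_word :: "'a word" where
  "0 = Word []"

definition plus_word :: "'a word \<Rightarrow> 'a word \<Rightarrow> 'a word" where
  "v + w = Word (letters v @ letters w)"

instance
  by standard (simp_all add: zero_word_def plus_word_def)

end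

type_synonym ('x, 'k) free_algebra = "'x word \<Rightarrow>\<^sub>0 'k"

definition gen :: "'x \<Rightarrow> ('x, 'k::field) free_algebra" where
  "gen x = Poly_Mapping.single (Word [x]) 1"

definition scalar :: "'k::field \<Rightarrow> ('x, 'k) free_algebra" where
  "scalar c = Poly_Mapping.single 0 c"

lemma ring_of_type_algebra_ring: "ring (ring_of_type_algebra :: 'a::ring_1 ring)"
proof -
  have "\<exists>y. x + y = 0" for x :: 'a
    using add.right_inverse by blast
  then show ?thesis
    unfolding ring_of_type_algebra_def using add.right_inverse
    by unfold_locales (auto simp: algebra_simps Units_def)
qed

text \<open>
  A pair \<open>(a, b)\<close> in \<open>Rel\<close> stands for the relation \<open>a = b\<close>.  Ideals in HOL-Algebra, and hence the
  ideals generated by \<^const>\<open>genideal\<close>, are two-sided.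
\<close>

definition relation_ideal ::
    "(('x, 'k::field) free_algebra \<times> ('x, 'k) free_algebra) set \<Rightarrow> ('x, 'k) free_algebra set" where
  "relation_ideal Rel = genideal ring_of_type_algebra {a - b | a b. (a, b) \<in> Rel}"

definition presented_algebra ::
    "(('x, 'k::field) free_algebra \<times> ('x, 'k) free_algebra) set \<Rightarrow> ('x, 'k) free_algebra set ring" where
  "presented_algebra Rel = ring_of_type_algebra Quot relation_ideal Rel"

definition presented_class ::
    "(('x, 'k::field) free_algebra \<times> ('x, 'k) free_algebra) set
      \<Rightarrow> ('x, 'k) free_algebra \<Rightarrow> ('x, 'k) free_algebra set" where
  "presented_class Rel a = relation_ideal Rel +>\<^bsub>ring_of_type_algebra\<^esub> a"

lemma relation_ideal_ideal: "ideal (relation_ideal Rel) ring_of_type_algebra"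
  unfolding relation_ideal_def
  by (rule ring.genideal_ideal[OF ring_of_type_algebra_ring]) (simp add: ring_of_type_algebra_def)

lemma presented_algebra_ring: "ring (presented_algebra Rel)"
  unfolding presented_algebra_def by (rule ideal.quotient_is_ring[OF relation_ideal_ideal])

lemma presented_class_hom: "presented_class Rel \<in> ring_hom ring_of_type_algebra (presented_algebra Rel)"
  unfolding presented_algebra_def presented_class_def
  by (rule ideal.rcos_ring_hom[OF relation_ideal_ideal])


section \<open>Skew fields of fractions\<close>

locale skew_field = ring +
  assumes skew_field_Units: "Units R = carrier R - {\<zero>}"

text \<open>
  \<open>(Q, \<iota>)\<close> is a skew field of (right) fractions of \<open>R\<close>.  It exists iff \<open>R\<close> is a right Ore domain and
  is then unique up to a unique isomorphism under \<open>R\<close>; if \<open>R\<close> is also a left Ore domain, as is every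
  noetherian domain, then it consists of the left fractions as well.
\<close>

locale skew_field_of_fractions = R?: ring R + Q?: skew_field Q for R (structure) and Q (structure) +
  fixes \<iota>
  assumes embedding_hom: "\<iota> \<in> ring_hom R Q"
    and embedding_inj: "inj_on \<iota> (carrier R)"
    and fraction: "q \<in> carrier Q \<Longrightarrow>
      \<exists>a \<in> carrier R. \<exists>b \<in> carrier R - {\<zero>}. q = \<iota> a \<otimes>\<^bsub>Q\<^esub> inv\<^bsub>Q\<^esub> \<iota> b"


section \<open>The double of the Jordan plane\<close>

datatype jordan_gen = Gen_u | Gen_v | Gen_zeta | Gen_g | Gen_g_inv | Gen_x | Gen_y

definition jordan_relations ::
    "((jordan_gen, 'k::field) free_algebra \<times> (jordan_gen, 'k) free_algebra) set" where
  "jordan_relations =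
    (let u = gen Gen_u; v = gen Gen_v; \<zeta> = gen Gen_zeta; g = gen Gen_g; g' = gen Gen_g_inv;
         x = gen Gen_x; y = gen Gen_y
     in {(g * g', 1), (g' * g, 1),
         (\<zeta> * g, g * \<zeta>),
         (g * x, x * g),
         (g * y, y * g + x * g),
         (\<zeta> * y, y * \<zeta> + y),
         (\<zeta> * x, x * \<zeta> + x),
         (u * g, g * u),
         (v * g, g * v + g * u),
         (v * \<zeta>, \<zeta> * v + v),
         (u * \<zeta>, \<zeta> * u + u),
         (y * x, x * y - scalar (1 / 2) * x ^ 2),
         (v * u, u * v - scalar (1 / 2) * u ^ 2),
         (u * x, x * u),
         (v * x, x * v + (1 - g) + x * u),
         (u * y, y * u + (1 - g)),
         (v * y, y * v - g * \<zeta> + y * u)})"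

abbreviation jordan_double :: "(jordan_gen, 'k::field) free_algebra set ring" where
  "jordan_double \<equiv> presented_algebra jordan_relations"


section \<open>Weyl algebras over rational function fields\<close>

text \<open>
  The Weyl algebra \<open>A\<^sub>n(K)\<close> is indexed by a type \<open>'n\<close> with \<open>n\<close> elements.
\<close>

datatype 'n weyl_gen = WQ 'n | WP 'n

definition weyl_relations ::
    "(('n weyl_gen, 'K::field) free_algebra \<times> ('n weyl_gen, 'K) free_algebra) set" where
  "weyl_relations =
    {(gen (WP i) * gen (WQ j) - gen (WQ j) * gen (WP i), if i = j then 1 else 0) | i j. True} \<union>
    {(gen (WQ i) * gen (WQ j), gen (WQ j) * gen (WQ i)) | i j. True} \<union>
    {(gen (WP i) * gen (WP j), gen (WP j) * gen (WP i)) | i j. True}"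

abbreviation weyl_algebra :: "('n weyl_gen, 'K::field) free_algebra set ring" where
  "weyl_algebra \<equiv> presented_algebra weyl_relations"

text \<open>
  The field \<open>\<k>(z\<^sub>1, \<dots>, z\<^sub>s)\<close>: fractions of polynomials in variables indexed by a type \<open>'s\<close> with \<open>s\<close>
  elements, a polynomial being a finitely supported map from exponent vectors to coefficients.
  (A linear order on \<open>'s\<close> is what the library needs to see that the polynomials form a domain.)
\<close>

type_synonym ('s, 'k) rational_functions = "(('s \<Rightarrow>\<^sub>0 nat) \<Rightarrow>\<^sub>0 'k) fract"

definition rat_const :: "'k::field \<Rightarrow> ('s::linorder, 'k) rational_functions" where
  "rat_const c = Fract (Poly_Mapping.single 0 c) 1"

text \<open>
  \<open>(L, \<kappa>)\<close> is the Weyl skew field \<open>D\<^sub>n\<^sub>,\<^sub>s(\<k>)\<close> for \<open>n = CARD('n)\<close> and \<open>s = CARD('s)\<close>.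
\<close>

abbreviation weyl_skew_field ::
    "'l ring \<Rightarrow> (('n::finite weyl_gen, ('s::{finite,linorder}, 'k::field) rational_functions) free_algebra set \<Rightarrow> 'l)
      \<Rightarrow> bool" where
  "weyl_skew_field L \<kappa> \<equiv> skew_field_of_fractions weyl_algebra L \<kappa>"


section \<open>Structure maps over the ground field\<close>

text \<open>
  The images of a scalar \<open>c \<in> \<k>\<close> in (a skew field of fractions of) the double of the Jordan plane and
  in a Weyl skew field; in the latter case \<open>\<k>\<close> is embedded through \<open>K = \<k>(z\<^sub>1, \<dots>, z\<^sub>s)\<close>.
\<close>

definition jordan_scalar ::
    "((jordan_gen, 'k::field) free_algebra set \<Rightarrow> 'q) \<Rightarrow> 'k \<Rightarrow> 'q" where
  "jordan_scalar \<iota> c = \<iota> (presented_class jordan_relations (scalar c))"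

definition weyl_scalar ::
    "(('n weyl_gen, ('s::linorder, 'k::field) rational_functions) free_algebra set \<Rightarrow> 'l)
      \<Rightarrow> 'k \<Rightarrow> 'l" where
  "weyl_scalar \<kappa> c = \<kappa> (presented_class weyl_relations (scalar (rat_const c)))"

end

theory Submission
  imports Defs
begin

text \<open>
  Put \<open>w = (x u + 2 + 2 g) g\<^sup>-\<^sup>1\<close>.  The double has the central elements \<open>z = w\<^sup>2 g\<close> and
  \<open>\<theta> = w (x v + u y - (1 - g + x u / 2) \<zeta> - 2 - 2 g)\<close>, and in its skew field of fractions the pairs
  \<open>(x, x\<^sup>-\<^sup>1 \<zeta>)\<close> and \<open>(w, w\<^sup>-\<^sup>1 x\<^sup>-\<^sup>1 (2 y + x \<zeta>))\<close> satisfy the relations of the second Weyl algebra over \<open>\<k>[z, \<theta>]\<close>.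
  Conversely \<open>g = w\<^sup>-\<^sup>2 z\<close>, \<open>u = x\<^sup>-\<^sup>1 (w g - 2 - 2 g)\<close>, \<open>y\<close> and, through \<open>\<theta>\<close>, also \<open>v\<close> are rational in
  these elements.  That \<open>z\<close> and \<open>\<theta>\<close> are algebraically independent is seen in a representation of the double on
  formal series in \<open>x\<close> and \<open>w\<close>, in which they act as indeterminate scalars.  Hence \<open>\<k>(z, \<theta>)\<close> embeds, and the
  resulting map from \<open>A\<^sub>2(\<k>(z, \<theta>))\<close> is injective because that algebra is simple; it extends to the
  skew fields of fractions.  No basis of the double is needed.
\<close>


section \<open>Homomorphisms from monoid algebras and free algebras\<close>

text \<open>The isomorphism is built from \<open>L\<close> to \<open>Q\<close> and inverted at the
  end. In this direction simplicity gives injectivity as soon as the target is nonzero, whereas a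
  map out of the double would need control of its kernel. Surjectivity is then a statement about
  generation: the image is closed under products and inverses, so it suffices to find the generators
  of the double in it. The Weyl pairs come from Euler operators. By
  \<open>\<zeta> * x = x * \<zeta> + x\<close>, bracketing with \<zeta> acts on \<open>x\<close> as
  \<open>x d/dx\<close>, so dividing \<zeta> by \<open>x\<close> gives \<open>d/dx\<close>. For a
  second, independent pair the operator \<open>y\<close> is corrected to
  \<open>2 * y + x * \<zeta>\<close>, which commutes with \<open>x\<close>; divided by
  \<open>x\<close> it also commutes with \<zeta> and acts on \<open>w\<close> as
  \<open>w d/dw\<close>. One more division, by \<open>w\<close>, gives \<open>d/dw\<close>. The
  fractions are noncommutative and \<open>Q\<close> and \<open>L\<close> are given abstractly, so
  common denominators have to be extracted from the hypothesis that every element is a right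
  fraction.\<close>

abbreviation type_ring :: "'a::ring_1 ring" where
  "type_ring \<equiv> ring_of_type_algebra"

lemma type_ring_simps [simp]:
  "carrier type_ring = UNIV" "monoid.mult type_ring = (*)" "monoid.one type_ring = 1"
  "ring.zero type_ring = 0" "ring.add type_ring = (+)"
  by (simp_all add: ring_of_type_algebra_def)

lemma type_ring_hom_iff:
  "h \<in> ring_hom type_ring R \<longleftrightarrow>
    (\<forall>a. h a \<in> carrier R) \<and> (\<forall>a b. h (a * b) = h a \<otimes>\<^bsub>R\<^esub> h b) \<and>
    (\<forall>a b. h (a + b) = h a \<oplus>\<^bsub>R\<^esub> h b) \<and> h 1 = \<one>\<^bsub>R\<^esub>"
  unfolding ring_hom_def by (auto simp: Pi_iff)

locale type_hom = R?: ring R for R (structure) +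
  fixes h :: "'t::ring_1 \<Rightarrow> 'a"
  assumes hom: "h \<in> ring_hom type_ring R"
begin

lemma closed [simp, intro]: "h a \<in> carrier R"
  and hom_mult: "h (a * b) = h a \<otimes> h b"
  and hom_add: "h (a + b) = h a \<oplus> h b"
  and hom_one: "h 1 = \<one>"
  using hom unfolding type_ring_hom_iff by auto

lemma hom_zero: "h 0 = \<zero>"
  using hom_add[of 0 0] by (metis R.add.l_cancel_one' add_0 closed)

lemma hom_uminus: "h (- a) = \<ominus> h a"
  using hom_add[of "- a" a] by (simp add: hom_zero R.minus_equality)

lemma hom_diff: "h (a - b) = h a \<ominus> h b"
  using hom_add[of a "- b"] by (simp add: hom_uminus R.minus_eq)

lemma hom_eq_iff: "h a = h b \<longleftrightarrow> h (a - b) = \<zero>"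
  by (simp add: hom_diff)

lemmas hom_simps = hom_mult hom_add hom_one hom_zero hom_uminus hom_diff

end

lemma poly_mapping_single_induct [case_names single add]:
  assumes "\<And>m c. P (Poly_Mapping.single m c)" "\<And>p q. P p \<Longrightarrow> P q \<Longrightarrow> P (p + q)"
  shows "P (p :: 'm \<Rightarrow>\<^sub>0 'c::comm_monoid_add)"
proof (induction p rule: update_induct)
  case const
  then show ?case using assms(1)[of undefined 0] by simp
next
  case (update f a b)
  have "Poly_Mapping.update a b f = f + Poly_Mapping.single a b"
    using update(1) by (intro poly_mapping_eqI)
      (auto simp: lookup_update lookup_add lookup_single in_keys_iff when_def)
  then show ?case using update assms by simp
qed

text \<open>The universal property is proved once for polynomials (exponent vectors) and free
  algebras (words). Only scalars and monomials must commute with each other, so the target may be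
  noncommutative.\<close>

lemma (in ring) monoid_algebra_hom:
  fixes \<sigma> :: "'k::ring_1 \<Rightarrow> 'a" and W :: "'m::monoid_add \<Rightarrow> 'a"
  assumes \<sigma>: "\<sigma> \<in> ring_hom type_ring R"
    and W: "\<And>m. W m \<in> carrier R" "W 0 = \<one>" "\<And>m n. W (m + n) = W m \<otimes> W n"
    and comm: "\<And>c m. \<sigma> c \<otimes> W m = W m \<otimes> \<sigma> c"
  obtains h :: "('m \<Rightarrow>\<^sub>0 'k) \<Rightarrow> 'a" where "h \<in> ring_hom type_ring R"
    and "\<And>m c. h (Poly_Mapping.single m c) = \<sigma> c \<otimes> W m"
proof -
  interpret \<sigma>: type_hom R \<sigma> by unfold_locales (rule \<sigma>)
  define h where "h p = (\<Oplus>m\<in>Poly_Mapping.keys p. \<sigma> (Poly_Mapping.lookup p m) \<otimes> W m)" for p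
  \<comment> \<open>Supports can shrink under addition, so sums are compared over a common finite
    superset.\<close>
  have h_super: "h p = (\<Oplus>m\<in>A. \<sigma> (Poly_Mapping.lookup p m) \<otimes> W m)"
    if "finite A" "Poly_Mapping.keys p \<subseteq> A" for p A
    unfolding h_def using that W
    by (intro add.finprod_mono_neutral_cong_left) (auto simp: in_keys_iff \<sigma>.hom_zero)
  have closed: "h p \<in> carrier R" for p
    unfolding h_def by (rule finsum_closed) (auto simp: W)
  have h_single: "h (Poly_Mapping.single m c) = \<sigma> c \<otimes> W m" for m c
    by (subst h_super[of "{m}"]) (auto simp: W)
  have h_add: "h (p + q) = h p \<oplus> h q" for p q
  proof -
    define A where "A = Poly_Mapping.keys p \<union> Poly_Mapping.keys q"
    have "h (p + q) = (\<Oplus>m\<in>A. \<sigma> (Poly_Mapping.lookup p m) \<otimes> W m \<oplus> \<sigma> (Poly_Mapping.lookup q m) \<otimes> W m)"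
      by (subst h_super[of A])
        (use Poly_Mapping.keys_add[of p q] in \<open>auto simp: A_def lookup_add \<sigma>.hom_add l_distr W intro!: finsum_cong'\<close>)
    also have "\<dots> = h p \<oplus> h q"
      by (subst finsum_addf) (auto simp: W A_def h_super[of A])
    finally show ?thesis .
  qed
  have mult_single: "h (Poly_Mapping.single m c * q) = h (Poly_Mapping.single m c) \<otimes> h q" for m c q
  proof (induction q rule: poly_mapping_single_induct)
    case (single n d)
    have "\<sigma> c \<otimes> W m \<otimes> (\<sigma> d \<otimes> W n) = \<sigma> c \<otimes> (W m \<otimes> \<sigma> d) \<otimes> W n"
      by (simp add: W m_assoc)
    also have "\<dots> = \<sigma> c \<otimes> \<sigma> d \<otimes> (W m \<otimes> W n)"
      by (simp add: W m_assoc comm[symmetric])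
    finally show ?case
      by (simp add: h_single Poly_Mapping.mult_single \<sigma>.hom_mult W)
  qed (simp add: distrib_left h_add closed r_distr)
  have "h (p * q) = h p \<otimes> h q" for p q
    by (induction p rule: poly_mapping_single_induct)
      (simp_all add: mult_single distrib_right h_add closed l_distr)
  moreover have "h 1 = \<one>"
    using h_single[of 0 1] by (simp add: \<sigma>.hom_one W)
  ultimately show ?thesis
    using that[of h] by (auto simp: type_ring_hom_iff closed h_add h_single)
qed

lemma gen_mult_single: "gen x * Poly_Mapping.single (Word w) c = Poly_Mapping.single (Word (x # w)) c"
  by (simp add: gen_def Poly_Mapping.mult_single plus_word_def)

lemma scalar_central: "scalar c * a = a * scalar (c::'k::field)"
  by (induction a rule: poly_mapping_single_induct)
    (simp_all add: scalar_def Poly_Mapping.mult_single algebra_simps)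

lemma scalar_simps:
  "scalar (c + d) = scalar c + scalar d" "scalar (c * d) = scalar c * scalar d"
  "scalar 1 = 1" "scalar 0 = 0" "scalar (- c) = - scalar c" "scalar (c - d) = scalar c - scalar d"
  by (simp_all add: scalar_def Poly_Mapping.single_add Poly_Mapping.mult_single
      Poly_Mapping.single_uminus Poly_Mapping.single_diff)

lemma free_algebra_induct [case_names scalar gen_mult add]:
  assumes "\<And>c. P (scalar c)" "\<And>x a. P a \<Longrightarrow> P (gen x * a)" "\<And>a b. P a \<Longrightarrow> P b \<Longrightarrow> P (a + b)"
  shows "P (a :: ('x, 'k::field) free_algebra)"
proof (induction a rule: poly_mapping_single_induct)
  case (single w c)
  have "P (Poly_Mapping.single (Word l) c)" for l
    using assms(1)[of c] by (induction l) (auto simp: gen_mult_single[symmetric] assms scalar_def zero_word_def)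
  then show ?case by (metis word.exhaust)
qed (rule assms)

lemma (in ring) free_algebra_hom:
  fixes \<sigma> :: "'k::field \<Rightarrow> 'a" and \<gamma> :: "'x \<Rightarrow> 'a"
  assumes \<sigma>: "\<sigma> \<in> ring_hom type_ring R"
    and \<gamma>: "\<And>x. \<gamma> x \<in> carrier R"
    and comm: "\<And>c x. \<sigma> c \<otimes> \<gamma> x = \<gamma> x \<otimes> \<sigma> c"
  obtains h where "h \<in> ring_hom type_ring R"
    and "\<And>x. h (gen x) = \<gamma> x" and "\<And>c. h (scalar c) = \<sigma> c"
proof -
  interpret \<sigma>: type_hom R \<sigma> by unfold_locales (rule \<sigma>)
  define V where "V = foldr (\<lambda>x r. \<gamma> x \<otimes> r)"
  have V_closed: "V l \<one> \<in> carrier R" for l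
    by (induction l) (auto simp: V_def \<gamma>)
  have V_append: "V (l @ l') \<one> = V l \<one> \<otimes> V l' \<one>" for l l'
    by (induction l) (use V_closed \<gamma> in \<open>auto simp: V_def m_assoc\<close>)
  have V_comm: "\<sigma> c \<otimes> V l \<one> = V l \<one> \<otimes> \<sigma> c" for c l
  proof (induction l)
    case (Cons x l)
    have "\<sigma> c \<otimes> (\<gamma> x \<otimes> V l \<one>) = \<gamma> x \<otimes> (\<sigma> c \<otimes> V l \<one>)"
      by (metis \<sigma>.closed \<gamma> V_closed comm m_assoc)
    then show ?case
      using Cons by (simp add: V_def) (metis V_def \<sigma>.closed \<gamma> V_closed m_assoc)
  qed (simp add: V_def)
  obtain h :: "('x, 'k) free_algebra \<Rightarrow> 'a" where h: "h \<in> ring_hom type_ring R"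
    "\<And>m c. h (Poly_Mapping.single m c) = \<sigma> c \<otimes> V (letters m) \<one>"
    using monoid_algebra_hom[OF \<sigma>, of "\<lambda>w. V (letters w) \<one>"]
    by (metis V_append V_closed V_comm V_def foldr.simps(1) id_apply plus_word_def word.sel zero_word_def)
  show ?thesis
    by (rule that[OF h(1)]) (simp_all add: h(2) gen_def scalar_def V_def zero_word_def \<gamma> \<sigma>.hom_one)
qed

section \<open>Extending homomorphisms to skew fields of fractions\<close>

context skew_field
begin

lemma unitI: "a \<in> carrier R \<Longrightarrow> a \<noteq> \<zero> \<Longrightarrow> a \<in> Units R"
  using skew_field_Units by blast

lemma one_nonzero: "\<one> \<noteq> \<zero>"
  using skew_field_Units Units_one_closed by blast

lemma integral:
  assumes "a \<in> carrier R" "b \<in> carrier R" "a \<noteq> \<zero>" "b \<noteq> \<zero>"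
  shows "a \<otimes> b \<noteq> \<zero>"
  using Units_m_closed[OF unitI unitI, of a b] assms skew_field_Units by auto

lemma right_cancel:
  assumes "a \<otimes> c = b \<otimes> c" "a \<in> carrier R" "b \<in> carrier R" "c \<in> carrier R" "c \<noteq> \<zero>"
  shows "a = b"
proof -
  have "c \<in> Units R" using assms unitI by blast
  then show ?thesis using assms(1-4)
    by (metis Units_inv_closed Units_r_inv m_assoc r_one)
qed

lemma left_cancel:
  assumes "c \<otimes> a = c \<otimes> b" "a \<in> carrier R" "b \<in> carrier R" "c \<in> carrier R" "c \<noteq> \<zero>"
  shows "a = b"
proof -
  have "c \<in> Units R" using assms unitI by blast
  then show ?thesis using assms(1-4) Units_l_cancel by blast
qed

lemma commutes_inv:
  assumes "a \<otimes> c = c \<otimes> a" "a \<in> carrier R" "c \<in> carrier R" "a \<noteq> \<zero>"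
  shows "inv a \<otimes> c = c \<otimes> inv a"
proof -
  have a: "a \<in> Units R" using assms unitI by blast
  have "inv a \<otimes> c = inv a \<otimes> (c \<otimes> a) \<otimes> inv a"
    using a assms(2,3) by (simp add: m_assoc)
  also have "\<dots> = inv a \<otimes> (a \<otimes> c) \<otimes> inv a" by (simp add: assms(1))
  also have "\<dots> = c \<otimes> inv a"
    using a assms(2,3) by (simp add: m_assoc[symmetric])
  finally show ?thesis .
qed

lemma commutes_mult:
  assumes "a \<otimes> c = c \<otimes> a" "b \<otimes> c = c \<otimes> b" "a \<in> carrier R" "b \<in> carrier R" "c \<in> carrier R"
  shows "(a \<otimes> b) \<otimes> c = c \<otimes> (a \<otimes> b)"
  using assms by (metis m_assoc)

end

text \<open>Universal property of right fractions for two maps with equal kernels. Neither map has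
  to be injective, so a free algebra can be the source without passing to its quotient. The
  instances are polynomials inside their fraction field and the free algebra on the Weyl generators
  mapped to \<open>L\<close>.\<close>

locale fraction_extension =
  L: skew_field L + Q: skew_field Q + h1: type_hom L h1 + h2: type_hom Q h2
  for L :: "'l ring" and Q :: "'q ring" and h1 :: "'t::ring_1 \<Rightarrow> 'l" and h2 :: "'t \<Rightarrow> 'q" +
  assumes kernel: "h1 a = \<zero>\<^bsub>L\<^esub> \<longleftrightarrow> h2 a = \<zero>\<^bsub>Q\<^esub>"
    and fractions: "q \<in> carrier L \<Longrightarrow> \<exists>a b. h1 b \<noteq> \<zero>\<^bsub>L\<^esub> \<and> q \<otimes>\<^bsub>L\<^esub> h1 b = h1 a"
begin

lemma transport: "h1 a = h1 b \<longleftrightarrow> h2 a = h2 b"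
  by (simp only: h1.hom_eq_iff h2.hom_eq_iff kernel)

lemma denominator:
  assumes "q \<in> carrier L"
  obtains a b where "h1 b \<noteq> \<zero>\<^bsub>L\<^esub>" "q \<otimes>\<^bsub>L\<^esub> h1 b = h1 a"
  using fractions[OF assms] by blast

text \<open>The right Ore condition comes from the fractions themselves: the inverse of
  \<open>h1 c\<close> times \<open>h1 a\<close> is again a right fraction, with numerator
  \<open>h1 t\<close> and denominator \<open>h1 s\<close>.\<close>

lemma ore:
  assumes "h1 c \<noteq> \<zero>\<^bsub>L\<^esub>"
  obtains s t where "h1 s \<noteq> \<zero>\<^bsub>L\<^esub>" "h1 (a * s) = h1 (c * t)"
proof -
  have c: "h1 c \<in> Units L" using assms L.unitI by blast
  have "inv\<^bsub>L\<^esub> h1 c \<otimes>\<^bsub>L\<^esub> h1 a \<in> carrier L"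
    using c by simp
  then obtain s t where st: "h1 s \<noteq> \<zero>\<^bsub>L\<^esub>"
      "inv\<^bsub>L\<^esub> h1 c \<otimes>\<^bsub>L\<^esub> h1 a \<otimes>\<^bsub>L\<^esub> h1 s = h1 t"
    using denominator by metis
  have "h1 c \<otimes>\<^bsub>L\<^esub> h1 t = h1 c \<otimes>\<^bsub>L\<^esub> inv\<^bsub>L\<^esub> h1 c \<otimes>\<^bsub>L\<^esub> h1 a \<otimes>\<^bsub>L\<^esub> h1 s"
    unfolding st(2)[symmetric] using c by (simp only: L.m_assoc L.m_closed L.Units_inv_closed h1.closed)
  also have "\<dots> = h1 a \<otimes>\<^bsub>L\<^esub> h1 s"
    using c by (simp only: L.Units_r_inv L.l_one h1.closed)
  finally show ?thesis
    by (intro that[OF st(1), of t]) (simp only: h1.hom_mult)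
qed

definition ext_rel :: "'l \<Rightarrow> 'q \<Rightarrow> bool" where
  "ext_rel q r \<longleftrightarrow> r \<in> carrier Q \<and>
    (\<exists>a b. h1 b \<noteq> \<zero>\<^bsub>L\<^esub> \<and> q \<otimes>\<^bsub>L\<^esub> h1 b = h1 a \<and> r \<otimes>\<^bsub>Q\<^esub> h2 b = h2 a)"

text \<open>Independence of the chosen fraction: the two denominators get a common right multiple,
  the resulting equation of numerators moves to \<open>Q\<close> by equality of kernels, and
  \<open>h2 s\<close> is cancelled. The new denominator \<open>d\<close> may even be mapped to
  zero.\<close>

lemma ext_relD:
  assumes "ext_rel q r" and q: "q \<in> carrier L" and c: "q \<otimes>\<^bsub>L\<^esub> h1 d = h1 c"
  shows "r \<otimes>\<^bsub>Q\<^esub> h2 d = h2 c"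
proof -
  obtain a b where r: "r \<in> carrier Q" and b: "h1 b \<noteq> \<zero>\<^bsub>L\<^esub>" and a: "q \<otimes>\<^bsub>L\<^esub> h1 b = h1 a"
    and a': "r \<otimes>\<^bsub>Q\<^esub> h2 b = h2 a"
    using assms(1) unfolding ext_rel_def by blast
  obtain s t where s: "h1 s \<noteq> \<zero>\<^bsub>L\<^esub>" and st: "h1 (d * s) = h1 (b * t)"
    using ore b by blast
  have "h1 (c * s) = h1 (a * t)"
    using q st by (simp add: h1.hom_mult a[symmetric] c[symmetric] L.m_assoc)
  then have st2: "h2 (c * s) = h2 (a * t)" and st': "h2 (d * s) = h2 (b * t)"
    using st by (simp_all only: transport)
  have "r \<otimes>\<^bsub>Q\<^esub> h2 d \<otimes>\<^bsub>Q\<^esub> h2 s = h2 c \<otimes>\<^bsub>Q\<^esub> h2 s"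
    using r st2 st' by (simp add: h2.hom_mult a'[symmetric] Q.m_assoc)
  then show ?thesis
    using Q.right_cancel[OF _ _ h2.closed h2.closed] r s kernel Q.m_closed h2.closed by blast
qed

lemma ext_rel_total: "q \<in> carrier L \<Longrightarrow> \<exists>r. ext_rel q r"
proof -
  assume "q \<in> carrier L"
  then obtain a b where ab: "h1 b \<noteq> \<zero>\<^bsub>L\<^esub>" "q \<otimes>\<^bsub>L\<^esub> h1 b = h1 a"
    by (rule denominator)
  then have "h2 b \<in> Units Q" using kernel Q.unitI by auto
  then have "h2 a \<otimes>\<^bsub>Q\<^esub> inv\<^bsub>Q\<^esub> h2 b \<otimes>\<^bsub>Q\<^esub> h2 b = h2 a"
      "h2 a \<otimes>\<^bsub>Q\<^esub> inv\<^bsub>Q\<^esub> h2 b \<in> carrier Q"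
    by (simp_all add: Q.m_assoc)
  then show ?thesis unfolding ext_rel_def using ab by blast
qed

definition ext :: "'l \<Rightarrow> 'q" where
  "ext q = (SOME r. ext_rel q r)"

lemma ext_rel_ext: "q \<in> carrier L \<Longrightarrow> ext_rel q (ext q)"
  unfolding ext_def by (rule someI_ex[OF ext_rel_total])

lemma ext_closed: "q \<in> carrier L \<Longrightarrow> ext q \<in> carrier Q"
  using ext_rel_ext ext_rel_def by blast

lemma ext_eqD: "q \<in> carrier L \<Longrightarrow> q \<otimes>\<^bsub>L\<^esub> h1 b = h1 a \<Longrightarrow> ext q \<otimes>\<^bsub>Q\<^esub> h2 b = h2 a"
  using ext_relD ext_rel_ext by blast

lemma ext_eqI:
  assumes "q \<in> carrier L" "r \<in> carrier Q" "h1 b \<noteq> \<zero>\<^bsub>L\<^esub>" "q \<otimes>\<^bsub>L\<^esub> h1 b = h1 a" "r \<otimes>\<^bsub>Q\<^esub> h2 b = h2 a"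
  shows "ext q = r"
proof (rule Q.right_cancel[OF _ ext_closed[OF assms(1)] assms(2) h2.closed])
  show "ext q \<otimes>\<^bsub>Q\<^esub> h2 b = r \<otimes>\<^bsub>Q\<^esub> h2 b"
    using ext_eqD[OF assms(1,4)] assms(5) by (rule trans[OF _ sym])
  show "h2 b \<noteq> \<zero>\<^bsub>Q\<^esub>" using assms(3) kernel by blast
qed

lemma ext_base: "ext (h1 a) = h2 a"
  by (rule ext_eqI[of _ _ 1 a]) (simp_all add: h1.hom_one h2.hom_one L.one_nonzero)

lemma ext_add:
  assumes q: "q \<in> carrier L" and q': "q' \<in> carrier L"
  shows "ext (q \<oplus>\<^bsub>L\<^esub> q') = ext q \<oplus>\<^bsub>Q\<^esub> ext q'"
proof -
  obtain a b where b: "h1 b \<noteq> \<zero>\<^bsub>L\<^esub>" and a: "q \<otimes>\<^bsub>L\<^esub> h1 b = h1 a"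
    using q by (rule denominator)
  obtain c d where d: "h1 d \<noteq> \<zero>\<^bsub>L\<^esub>" and c: "q' \<otimes>\<^bsub>L\<^esub> h1 d = h1 c"
    using q' by (rule denominator)
  obtain s t where s: "h1 s \<noteq> \<zero>\<^bsub>L\<^esub>" and st: "h1 (d * s) = h1 (b * t)"
    using ore b by blast
  have 1: "q \<otimes>\<^bsub>L\<^esub> h1 (d * s) = h1 (a * t)"
    unfolding st using q by (simp add: h1.hom_mult L.m_assoc[symmetric] a)
  have 2: "q' \<otimes>\<^bsub>L\<^esub> h1 (d * s) = h1 (c * s)"
    using q' by (simp add: h1.hom_mult L.m_assoc[symmetric] c)
  show ?thesis
  proof (rule ext_eqI[of _ _ "d * s" "a * t + c * s"])
    show "h1 (d * s) \<noteq> \<zero>\<^bsub>L\<^esub>"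
      using L.integral[OF _ _ d s] by (simp add: h1.hom_mult)
    show "(q \<oplus>\<^bsub>L\<^esub> q') \<otimes>\<^bsub>L\<^esub> h1 (d * s) = h1 (a * t + c * s)"
      using q q' by (simp add: L.l_distr 1 2 h1.hom_add)
    show "(ext q \<oplus>\<^bsub>Q\<^esub> ext q') \<otimes>\<^bsub>Q\<^esub> h2 (d * s) = h2 (a * t + c * s)"
      using q q' ext_eqD[OF q 1] ext_eqD[OF q' 2]
      by (simp add: Q.l_distr h2.hom_add ext_closed)
  qed (use q q' in \<open>auto intro: ext_closed\<close>)
qed

lemma ext_mult:
  assumes q: "q \<in> carrier L" and q': "q' \<in> carrier L"
  shows "ext (q \<otimes>\<^bsub>L\<^esub> q') = ext q \<otimes>\<^bsub>Q\<^esub> ext q'"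
proof -
  obtain a b where b: "h1 b \<noteq> \<zero>\<^bsub>L\<^esub>" and a: "q' \<otimes>\<^bsub>L\<^esub> h1 b = h1 a"
    using q' by (rule denominator)
  obtain c d where d: "h1 d \<noteq> \<zero>\<^bsub>L\<^esub>" and c: "q \<otimes>\<^bsub>L\<^esub> h1 d = h1 c"
    using q by (rule denominator)
  \<comment> \<open>The numerator of \<open>q'\<close> and the denominator of \<open>q\<close> are
    given a common right multiple, so that the middle of the product cancels.\<close>
  obtain s t where s: "h1 s \<noteq> \<zero>\<^bsub>L\<^esub>" and st: "h1 (a * s) = h1 (d * t)"
    using ore d by blast
  have 1: "q' \<otimes>\<^bsub>L\<^esub> h1 (b * s) = h1 (a * s)"
    using q' by (simp add: h1.hom_mult L.m_assoc[symmetric] a)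
  have 2: "q \<otimes>\<^bsub>L\<^esub> h1 (a * s) = h1 (c * t)"
    unfolding st using q by (simp add: h1.hom_mult L.m_assoc[symmetric] c)
  show ?thesis
  proof (rule ext_eqI[of _ _ "b * s" "c * t"])
    show "h1 (b * s) \<noteq> \<zero>\<^bsub>L\<^esub>"
      using L.integral[OF _ _ b s] by (simp add: h1.hom_mult)
    show "q \<otimes>\<^bsub>L\<^esub> q' \<otimes>\<^bsub>L\<^esub> h1 (b * s) = h1 (c * t)"
      using q q' by (simp add: L.m_assoc 1 2)
    show "ext q \<otimes>\<^bsub>Q\<^esub> ext q' \<otimes>\<^bsub>Q\<^esub> h2 (b * s) = h2 (c * t)"
      using q q' by (simp add: Q.m_assoc ext_closed ext_eqD[OF q' 1] ext_eqD[OF q 2])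
  qed (use q q' in \<open>auto intro: ext_closed\<close>)
qed

lemma ext_inj: "inj_on ext (carrier L)"
proof (rule inj_onI)
  fix q q' assume q: "q \<in> carrier L" and q': "q' \<in> carrier L" and eq: "ext q = ext q'"
  obtain a b where b: "h1 b \<noteq> \<zero>\<^bsub>L\<^esub>" and a: "q \<otimes>\<^bsub>L\<^esub> h1 b = h1 a"
    using q by (rule denominator)
  obtain c d where d: "h1 d \<noteq> \<zero>\<^bsub>L\<^esub>" and c: "q' \<otimes>\<^bsub>L\<^esub> h1 d = h1 c"
    using q' by (rule denominator)
  obtain s t where s: "h1 s \<noteq> \<zero>\<^bsub>L\<^esub>" and st: "h1 (d * s) = h1 (b * t)"
    using ore b by blast
  have 1: "q \<otimes>\<^bsub>L\<^esub> h1 (d * s) = h1 (a * t)"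
    unfolding st using q by (simp add: h1.hom_mult L.m_assoc[symmetric] a)
  have 2: "q' \<otimes>\<^bsub>L\<^esub> h1 (d * s) = h1 (c * s)"
    using q' by (simp add: h1.hom_mult L.m_assoc[symmetric] c)
  have "h2 (a * t) = h2 (c * s)"
    using ext_eqD[OF q 1] ext_eqD[OF q' 2] by (simp only: eq)
  then have "h1 (a * t) = h1 (c * s)" by (simp only: transport)
  then have "q \<otimes>\<^bsub>L\<^esub> h1 (d * s) = q' \<otimes>\<^bsub>L\<^esub> h1 (d * s)" by (simp only: 1 2)
  moreover have "h1 (d * s) \<noteq> \<zero>\<^bsub>L\<^esub>"
    using L.integral[OF _ _ d s] by (simp add: h1.hom_mult)
  ultimately show "q = q'" using q q' L.right_cancel h1.closed by blast
qed

lemma ext_hom: "ext \<in> ring_hom L Q"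
  using ext_base[of 1] by (auto simp: ring_hom_def ext_closed ext_add ext_mult h1.hom_one h2.hom_one)

end

section \<open>Simplicity of the Weyl algebra\<close>

locale type_ideal =
  fixes I :: "'a::ring_1 set"
  assumes zero_mem: "0 \<in> I"
    and add_mem: "a \<in> I \<Longrightarrow> b \<in> I \<Longrightarrow> a + b \<in> I"
    and mult_left: "a \<in> I \<Longrightarrow> r * a \<in> I"
    and mult_right: "a \<in> I \<Longrightarrow> a * r \<in> I"
begin

lemma uminus_mem: "a \<in> I \<Longrightarrow> - a \<in> I"
  using mult_left[of a "- 1"] by simp

lemma diff_mem: "a \<in> I \<Longrightarrow> b \<in> I \<Longrightarrow> a - b \<in> I"
  using add_mem[of a "- b"] uminus_mem by simp

lemma sum_mem: "(\<And>i. i \<in> A \<Longrightarrow> f i \<in> I) \<Longrightarrow> sum f A \<in> I"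
  by (induction A rule: infinite_finite_induct) (auto simp: zero_mem add_mem)

lemma cong_mem: "a - b \<in> I \<Longrightarrow> a \<in> I \<longleftrightarrow> b \<in> I"
  using add_mem[of "a - b" b] diff_mem[of a "a - b"] by auto

end

lemma type_ideal_iff: "ideal I type_ring \<longleftrightarrow> type_ideal I"
proof
  assume I: "ideal I type_ring"
  have sub: "additive_subgroup I type_ring" by (rule ideal.axioms(1)[OF I])
  show "type_ideal I"
  proof
    show "0 \<in> I" using additive_subgroup.zero_closed[OF sub] by simp
    show "a + b \<in> I" if "a \<in> I" "b \<in> I" for a b
      using additive_subgroup.a_closed[OF sub that] by simp
    show "r * a \<in> I" "a * r \<in> I" if "a \<in> I" for a r
      using ideal.I_l_closed[OF I that] ideal.I_r_closed[OF I that] by simp_all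
  qed
next
  assume "type_ideal I"
  then interpret type_ideal I .
  have "inv\<^bsub>add_monoid type_ring\<^esub> a = - a" for a :: 'a
    using abelian_group.minus_equality[OF ring.is_abelian_group[OF ring_of_type_algebra_ring], of "- a" a]
    by (simp add: a_inv_def)
  then have "subgroup I (add_monoid type_ring)"
    by (intro subgroup.intro) (simp_all add: add_mem zero_mem uminus_mem)
  then show "ideal I type_ring"
    by (intro idealI ring_of_type_algebra_ring) (simp_all add: mult_left mult_right)
qed

text \<open>Polynomials in \<open>q\<close> with coefficients from \<open>S\<close> on the left, as
  a closure under right multiplication by \<open>q\<close>; no uniqueness of coefficients is built
  in.\<close>

inductive_set adjoin :: "'a::ring_1 set \<Rightarrow> 'a \<Rightarrow> 'a set" for S q where
  base: "s \<in> S \<Longrightarrow> s \<in> adjoin S q"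
| mult: "a \<in> adjoin S q \<Longrightarrow> a * q \<in> adjoin S q"
| add: "a \<in> adjoin S q \<Longrightarrow> b \<in> adjoin S q \<Longrightarrow> a + b \<in> adjoin S q"

lemma adjoin_mult_closed:
  assumes "\<And>a. a \<in> S \<Longrightarrow> a * r \<in> S"
    and "\<And>a. a \<in> adjoin S q \<Longrightarrow> a * (q * r - r * q) \<in> adjoin S q"
    and "a \<in> adjoin S q"
  shows "a * r \<in> adjoin S q"
  using assms(3)
proof induction
  case (mult a)
  have "a * q * r = a * r * q + a * (q * r - r * q)" by (simp add: algebra_simps)
  then show ?case using mult assms(2) by (metis adjoin.mult adjoin.add)
qed (auto simp: assms(1) distrib_right intro: adjoin.intros)

lemma adjoin_normal_form:
  assumes "a \<in> adjoin S q" and S: "0 \<in> S" "\<And>a b. a \<in> S \<Longrightarrow> b \<in> S \<Longrightarrow> a + b \<in> S"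
  obtains n s where "\<And>i. s i \<in> S" "a = (\<Sum>i\<le>n. s i * q ^ i)"
proof -
  have "\<exists>n s. (\<forall>i. s i \<in> S) \<and> a = (\<Sum>i\<le>n. s i * q ^ i)"
    using assms(1)
  proof induction
    case (base s)
    then show ?case by (intro exI[of _ 0] exI[of _ "\<lambda>_. s"]) simp
  next
    case (mult a)
    then obtain n s where s: "\<forall>i. s i \<in> S" "a = (\<Sum>i\<le>n. s i * q ^ i)" by blast
    \<comment> \<open>Multiplication by \<open>q\<close> moves every coefficient up one degree;
      \<open>case_nat 0 s\<close> is this shift.\<close>
    have "a * q = (\<Sum>i\<le>Suc n. case_nat 0 s i * q ^ i)"
      by (subst sum.atMost_Suc_shift) (simp add: s(2) sum_distrib_right mult.assoc power_commutes)
    moreover have "\<forall>i. case_nat 0 s i \<in> S" using s(1) S(1) by (simp split: nat.split)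
    ultimately show ?case by blast
  next
    case (add a b)
    then obtain n s m t where s: "\<forall>i. s i \<in> S" "a = (\<Sum>i\<le>n. s i * q ^ i)"
      and t: "\<forall>i. t i \<in> S" "b = (\<Sum>i\<le>m. t i * q ^ i)" by metis
    define r where "r i = (if i \<le> n then s i else 0) + (if i \<le> m then t i else 0)" for i
    have pad: "(\<Sum>i\<le>k. f i * q ^ i) = (\<Sum>i\<le>max n m. (if i \<le> k then f i else 0) * q ^ i)"
      if "k \<le> max n m" for f :: "nat \<Rightarrow> 'a" and k
      by (rule sum.mono_neutral_cong_left) (use that in auto)
    have "a + b = (\<Sum>i\<le>max n m. r i * q ^ i)"
      unfolding s(2) t(2) by (subst (1 2) pad) (auto simp: r_def distrib_right sum.distrib)
    moreover have "\<forall>i. r i \<in> S" using s(1) t(1) S by (simp add: r_def)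
    ultimately show ?case by blast
  qed
  then show ?thesis using that by blast
qed

context type_ideal
begin

definition centralizer :: "'a \<Rightarrow> 'a set" where
  "centralizer p = {a. p * a - a * p \<in> I}"

lemma adjoin_centralizer:
  assumes "S \<subseteq> centralizer p" "q \<in> centralizer p"
  shows "adjoin S q \<subseteq> centralizer p"
proof
  fix a assume "a \<in> adjoin S q"
  then show "a \<in> centralizer p"
  proof induction
    case (mult a)
    have "p * (a * q) - a * q * p = (p * a - a * p) * q + a * (p * q - q * p)"
      by (simp add: algebra_simps)
    then show ?case
      using mult assms(2) add_mem mult_left mult_right by (simp add: centralizer_def)
  next
    case (add a b)
    have "p * (a + b) - (a + b) * p = (p * a - a * p) + (p * b - b * p)"
      by (simp add: algebra_simps)
    then show ?case using add add_mem by (simp add: centralizer_def)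
  qed (use assms in auto)
qed

text \<open>Modulo \<open>I\<close>, bracketing with \<open>p\<close> is differentiation in
  \<open>q\<close>, since the coefficients commute with \<open>p\<close>. At \<open>i = 0\<close>
  the truncated exponent is harmless because its factor \<open>of_nat i\<close> vanishes.\<close>

lemma ad_power:
  assumes "s \<in> centralizer p" and "p * q - q * p - 1 \<in> I"
  shows "p * (s * q ^ i) - s * q ^ i * p - of_nat i * s * q ^ (i - 1) \<in> I"
proof (induction i)
  case 0
  then show ?case using assms by (simp add: centralizer_def)
next
  case (Suc i)
  have "of_nat i * s * q ^ (i - 1) * q = of_nat i * s * q ^ i"
    by (cases i) (simp_all add: power_commutes mult.assoc)
  then have "p * (s * q ^ Suc i) - s * q ^ Suc i * p - of_nat (Suc i) * s * q ^ (Suc i - 1) =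
    (p * (s * q ^ i) - s * q ^ i * p - of_nat i * s * q ^ (i - 1)) * q +
    s * q ^ i * (p * q - q * p - 1)"
    by (simp add: power_Suc2 algebra_simps del: power_Suc)
  then show ?case using Suc assms add_mem mult_left mult_right by simp
qed

text \<open>
  Applying \<open>ad p\<close> as often as possible isolates a nonzero multiple of the leading coefficient of a
  polynomial in \<open>q\<close>.
\<close>

lemma adjoin_contract:
  assumes J: "type_ideal J" "J \<subseteq> I"
    and S: "0 \<in> S" "\<And>a b. a \<in> S \<Longrightarrow> b \<in> S \<Longrightarrow> a + b \<in> S" "S \<inter> I \<subseteq> J"
    and p: "S \<subseteq> centralizer p" "p * q - q * p - 1 \<in> I"
    and inv: "\<And>n. n > 0 \<Longrightarrow> \<exists>c. c * of_nat n = (1::'a)"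
  shows "adjoin S q \<inter> I \<subseteq> J"
proof -
  interpret J: type_ideal J by (rule J)
  have scale: "of_nat n * s \<in> S" if "s \<in> S" for n s
    by (induction n) (auto simp: S distrib_right that)
  have lead: "s n \<in> J" if "\<And>i. s i \<in> S" "(\<Sum>i\<le>n. s i * q ^ i) \<in> I" for s n
    using that
  proof (induction n arbitrary: s)
    case 0
    then show ?case using S(3) by auto
  next
    case (Suc n)
    have "p * (\<Sum>i\<le>Suc n. s i * q ^ i) - (\<Sum>i\<le>Suc n. s i * q ^ i) * p
        - (\<Sum>i\<le>Suc n. of_nat i * s i * q ^ (i - 1)) \<in> I"
      unfolding sum_distrib_left sum_distrib_right sum_subtractf[symmetric]
      using ad_power p Suc.prems by (intro sum_mem) blast
    moreover have "p * (\<Sum>i\<le>Suc n. s i * q ^ i) - (\<Sum>i\<le>Suc n. s i * q ^ i) * p \<in> I"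
      using Suc.prems by (intro diff_mem mult_left mult_right)
    ultimately have "(\<Sum>i\<le>Suc n. of_nat i * s i * q ^ (i - 1)) \<in> I"
      using cong_mem by blast
    also have "(\<Sum>i\<le>Suc n. of_nat i * s i * q ^ (i - 1)) = (\<Sum>i\<le>n. of_nat (Suc i) * s (Suc i) * q ^ i)"
      by (subst sum.atMost_Suc_shift) simp
    \<comment> \<open>The induction hypothesis is applied to the derivative, whose leading
      coefficient carries the old degree as a factor. Characteristic zero, in the form of
      \<open>inv\<close>, removes that factor.\<close>
    finally have "of_nat (Suc n) * s (Suc n) \<in> J"
      using Suc.prems(1) by (intro Suc.IH[of "\<lambda>i. of_nat (Suc i) * s (Suc i)"] scale)
    moreover obtain c where "c * of_nat (Suc n) = (1::'a)" using inv by blast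
    ultimately show ?case
      using J.mult_left[of "of_nat (Suc n) * s (Suc n)" c] by (simp only: mult.assoc[symmetric] mult_1_left)
  qed
  \<comment> \<open>Only leading coefficients are reached by differentiation; the top term is
    therefore subtracted and the rest handled by induction.\<close>
  have sum: "(\<Sum>i\<le>n. s i * q ^ i) \<in> J" if "\<And>i. s i \<in> S" "(\<Sum>i\<le>n. s i * q ^ i) \<in> I" for s n
    using that
  proof (induction n)
    case (Suc n)
    then have top: "s (Suc n) * q ^ Suc n \<in> J"
      using J.mult_right lead by blast
    then have "(\<Sum>i\<le>n. s i * q ^ i) \<in> I"
      using Suc.prems(2) J(2) diff_mem[of "\<Sum>i\<le>Suc n. s i * q ^ i" "s (Suc n) * q ^ Suc n"] by auto
    then show ?case using Suc top J.add_mem by simp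
  qed (use lead[of _ 0] in auto)
  show ?thesis
  proof
    fix a assume a: "a \<in> adjoin S q \<inter> I"
    then have aS: "a \<in> adjoin S q" by blast
    obtain n s where "\<And>i. s i \<in> S" "a = (\<Sum>i\<le>n. s i * q ^ i)"
      using adjoin_normal_form[OF aS S(1,2)] by blast
    then show "a \<in> J" using sum a by blast
  qed
qed

end

section \<open>Relation ideals and spans of ordered monomials modulo them\<close>

lemma relation_ideal_type_ideal: "type_ideal (relation_ideal Rel)"
  using relation_ideal_ideal by (simp add: type_ideal_iff)

lemma relation_ideal_self: "(a, b) \<in> Rel \<Longrightarrow> a - b \<in> relation_ideal Rel"
  unfolding relation_ideal_def
  by (rule subsetD[OF ring.genideal_self[OF ring_of_type_algebra_ring]]) auto

lemma relation_ideal_minimal: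
  "type_ideal I \<Longrightarrow> (\<And>a b. (a, b) \<in> Rel \<Longrightarrow> a - b \<in> I) \<Longrightarrow> relation_ideal Rel \<subseteq> I"
  unfolding relation_ideal_def
  by (rule ring.genideal_minimal[OF ring_of_type_algebra_ring]) (auto simp: type_ideal_iff)

text \<open>The stages in the simplicity proof. Containing \<open>J\<close>, they allow the
  relations to be used as equations; closure under scalars lets them absorb the commutators of
  generators, which are scalars modulo \<open>J\<close>.\<close>

locale additive_superset =
  fixes J S :: "('x, 'k::field) free_algebra set"
  assumes J_subset: "J \<subseteq> S"
    and zero_closed: "0 \<in> S"
    and add_closed: "a \<in> S \<Longrightarrow> b \<in> S \<Longrightarrow> a + b \<in> S"
    and scalar_closed: "a \<in> S \<Longrightarrow> a * scalar c \<in> S"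

lemma additive_superset_adjoin:
  assumes "additive_superset J S"
  shows "additive_superset J (adjoin S q)"
proof -
  interpret additive_superset J S by (rule assms)
  have "a * scalar c \<in> adjoin S q" if "a \<in> adjoin S q" for a c
    using _ _ that
  proof (rule adjoin_mult_closed)
    show "a * (q * scalar c - scalar c * q) \<in> adjoin S q" if "a \<in> adjoin S q" for a
      using zero_closed by (simp add: scalar_central[of c q] adjoin.base)
  qed (rule scalar_closed)
  then show ?thesis
    using J_subset zero_closed by unfold_locales (auto intro: adjoin.intros)
qed


lemma additive_superset_mult_closed:
  assumes "additive_superset J S" and J: "type_ideal J"
    and "\<And>a. a \<in> S \<Longrightarrow> a * r \<in> S" and comm: "q * r - r * q - scalar c \<in> J"
    and "a \<in> adjoin S q"
  shows "a * r \<in> adjoin S q"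
  using assms(3) _ assms(5)
proof (rule adjoin_mult_closed)
  interpret A: additive_superset J "adjoin S q" by (rule additive_superset_adjoin) fact
  fix a assume a: "a \<in> adjoin S q"
  have "a * (q * r - r * q - scalar c) + a * scalar c \<in> adjoin S q"
    using A.J_subset type_ideal.mult_left[OF J comm]
    by (intro A.add_closed A.scalar_closed[OF a]) blast
  also have "a * (q * r - r * q - scalar c) + a * scalar c = a * (q * r - r * q)"
    by (simp add: algebra_simps)
  finally show "a * (q * r - r * q) \<in> adjoin S q" .
qed

lemma two_cases: "i = 0 \<or> i = (1::2)"
proof -
  have "UNIV = {0, 1::2}"
    by (rule card_seteq[symmetric]) simp_all
  then show ?thesis by blast
qed

lemma weyl_relation:
  shows "gen (WP i) * gen (WQ j) - gen (WQ j) * gen (WP i) - scalar (if i = j then 1 else 0)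
      \<in> relation_ideal (weyl_relations :: (('n weyl_gen, 'K::field) free_algebra \<times> _) set)"
    and "gen (WQ i) * gen (WQ j) - gen (WQ j) * gen (WQ i)
      \<in> relation_ideal (weyl_relations :: (('n weyl_gen, 'K::field) free_algebra \<times> _) set)"
    and "gen (WP i) * gen (WP j) - gen (WP j) * gen (WP i)
      \<in> relation_ideal (weyl_relations :: (('n weyl_gen, 'K::field) free_algebra \<times> _) set)"
  by (rule relation_ideal_self; force simp: weyl_relations_def scalar_simps)+

text \<open>The algebra is exhausted by adjoining \<open>?q0\<close>, \<open>?q1\<close>,
  \<open>?p0\<close>, \<open>?p1\<close> in turn to the scalars, all modulo \<open>J\<close>. Each
  of them has a conjugate, namely \<open>?p0\<close>, \<open>?p1\<close>, \<open>- ?q0\<close>,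
  \<open>- ?q1\<close>, that commutes with the stage before it, so \<open>adjoin_contract\<close>
  carries the inclusion of \<open>S \<inter> I\<close> in \<open>J\<close> from stage to
  stage.\<close>

lemma weyl_algebra_simple:
  fixes I :: "(2 weyl_gen, 'K::field) free_algebra set"
  assumes char: "\<And>n. n > 0 \<Longrightarrow> of_nat n \<noteq> (0::'K)"
    and I: "type_ideal I" "relation_ideal weyl_relations \<subseteq> I" "1 \<notin> I"
  shows "I \<subseteq> relation_ideal weyl_relations"
proof -
  define J where "J = (relation_ideal weyl_relations :: (2 weyl_gen, 'K) free_algebra set)"
  interpret I: type_ideal I by (rule I)
  have J: "type_ideal J" and JI: "J \<subseteq> I"
    using I relation_ideal_type_ideal by (auto simp: J_def)
  interpret J: type_ideal J by (rule J)
  note rels = weyl_relation[where 'n=2 and 'K='K, folded J_def]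
  let ?q0 = "gen (WQ (0::2)) :: (2 weyl_gen, 'K) free_algebra"
  let ?q1 = "gen (WQ (1::2)) :: (2 weyl_gen, 'K) free_algebra"
  let ?p0 = "gen (WP (0::2)) :: (2 weyl_gen, 'K) free_algebra"
  let ?p1 = "gen (WP (1::2)) :: (2 weyl_gen, 'K) free_algebra"
  define S0 where "S0 = {scalar c + j | c j. j \<in> J}"
  define S1 where "S1 = adjoin S0 ?q0"
  define S2 where "S2 = adjoin S1 ?q1"
  define S3 where "S3 = adjoin S2 ?p0"
  define S4 where "S4 = adjoin S3 ?p1"
  note S_defs = S1_def S2_def S3_def S4_def
  have A0: "additive_superset J S0"
  proof
    show "J \<subseteq> S0"
      unfolding S0_def by (force intro: exI[of _ 0] simp: scalar_simps)
    then show "0 \<in> S0" using J.zero_mem by blast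
  next
    fix a b assume "a \<in> S0" "b \<in> S0"
    then obtain c j d k where "a = scalar c + j" "b = scalar d + k" "j \<in> J" "k \<in> J"
      unfolding S0_def by blast
    moreover from this have "a + b = scalar (c + d) + (j + k)"
      by (simp add: scalar_simps algebra_simps)
    ultimately show "a + b \<in> S0" unfolding S0_def using J.add_mem by blast
  next
    fix a :: "(2 weyl_gen, 'K) free_algebra" and d assume "a \<in> S0"
    then obtain c j where "a = scalar c + j" "j \<in> J"
      unfolding S0_def by blast
    moreover from this have "a * scalar d = scalar (c * d) + j * scalar d"
      by (simp add: scalar_simps algebra_simps)
    ultimately show "a * scalar d \<in> S0" unfolding S0_def using J.mult_right by blast
  qed
  have A1: "additive_superset J S1" and A2: "additive_superset J S2"
    and A3: "additive_superset J S3" and A4: "additive_superset J S4"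
    unfolding S_defs by (intro additive_superset_adjoin A0)+
  note closed = additive_superset_mult_closed[OF _ J]
  have rel0: "?q1 * ?q0 - ?q0 * ?q1 - scalar 0 \<in> J" "?p1 * ?p0 - ?p0 * ?p1 - scalar 0 \<in> J"
    "?p0 * ?q1 - ?q1 * ?p0 - scalar 0 \<in> J" "?p1 * ?q0 - ?q0 * ?p1 - scalar 0 \<in> J"
    "?p0 * ?q0 - ?q0 * ?p0 - scalar 1 \<in> J" "?p1 * ?q1 - ?q1 * ?p1 - scalar 1 \<in> J"
    using rels(1)[of 0 0] rels(1)[of 1 1] rels(1)[of 0 1] rels(1)[of 1 0] rels(2)[of 1 0] rels(3)[of 1 0]
    by (simp_all add: scalar_simps)
  have 1: "a * ?q0 \<in> S1" if "a \<in> S1" for a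
    using that unfolding S1_def by (rule adjoin.mult)
  have 2: "a * ?q0 \<in> S2" "a * ?q1 \<in> S2" if "a \<in> S2" for a
    using that unfolding S2_def by (blast intro: adjoin.mult closed[OF A1 1 rel0(1)])+
  have 3: "a * ?q0 \<in> S3" "a * ?q1 \<in> S3" "a * ?p0 \<in> S3" if "a \<in> S3" for a
    using that unfolding S3_def
    by (blast intro: adjoin.mult closed[OF A2 2(1) rel0(5)] closed[OF A2 2(2) rel0(3)])+
  have 4: "a * ?q0 \<in> S4" "a * ?q1 \<in> S4" "a * ?p0 \<in> S4" "a * ?p1 \<in> S4" if "a \<in> S4" for a
    using that unfolding S4_def
    by (blast intro: adjoin.mult closed[OF A3 3(1) rel0(4)] closed[OF A3 3(2) rel0(6)]
        closed[OF A3 3(3) rel0(2)])+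
  interpret A4: additive_superset J S4 by (rule A4)
  \<comment> \<open>Absorbing each generator on the right and containing \<open>1\<close> makes
    \<open>S4\<close> the whole algebra; words are absorbed letter by letter from the left.\<close>
  have "a * r \<in> S4" if "a \<in> S4" for a r
    using that
  proof (induction r arbitrary: a rule: free_algebra_induct)
    case (gen_mult x r)
    have "a * gen x \<in> S4"
    proof (cases x)
      case (WQ i) then show ?thesis using 4 two_cases[of i] gen_mult.prems by auto
    next
      case (WP i) then show ?thesis using 4 two_cases[of i] gen_mult.prems by auto
    qed
    from gen_mult.IH[OF this] show ?case by (simp only: mult.assoc)
  qed (simp_all add: A4.scalar_closed A4.add_closed distrib_left)
  moreover have "1 \<in> S4"
  proof -
    have "1 \<in> S0" unfolding S0_def using J.zero_mem by (force intro: exI[of _ 1] simp: scalar_simps)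
    then show ?thesis unfolding S_defs by (intro adjoin.base)
  qed
  ultimately have S4_UNIV: "r \<in> S4" for r by (metis mult_1_left)

  \<comment> \<open>The earlier generators commute with the conjugate used at the next stage. The
    minus signs turn the commutators of \<open>?q0\<close> with \<open>?p0\<close> and of
    \<open>?q1\<close> with \<open>?p1\<close> into \<open>1\<close>.\<close>
  have C: "?q0 \<in> I.centralizer ?p1" "?q0 \<in> I.centralizer (- ?q1)" "?q1 \<in> I.centralizer (- ?q0)"
    "?q0 \<in> I.centralizer (- ?q0)" "?q1 \<in> I.centralizer (- ?q1)" "?p0 \<in> I.centralizer (- ?q1)"
    using rel0 rels(2)[of 0 1] JI I.uminus_mem I.zero_mem by (auto simp: I.centralizer_def scalar_simps)
  have C0: "S0 \<subseteq> I.centralizer p" for p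
  proof
    fix a assume "a \<in> S0"
    then obtain c j where a: "a = scalar c + j" "j \<in> J" unfolding S0_def by blast
    then have "p * a - a * p = p * j - j * p"
      by (simp add: algebra_simps scalar_central[of c p])
    then show "a \<in> I.centralizer p"
      using a JI by (auto simp: I.centralizer_def intro: I.diff_mem I.mult_left I.mult_right)
  qed
  have inv: "\<exists>c. c * of_nat n = (1 :: (2 weyl_gen, 'K) free_algebra)" if "n > 0" for n
  proof -
    have "scalar (of_nat m) = (of_nat m :: (2 weyl_gen, 'K) free_algebra)" for m
      by (induction m) (simp_all add: scalar_simps)
    then show ?thesis
      using char[OF that] by (intro exI[of _ "scalar (1 / of_nat n)"])
        (metis nonzero_eq_divide_eq scalar_simps(2,3))
  qed
  have contract: "adjoin S q \<inter> I \<subseteq> J"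
    if S: "additive_superset J S" "S \<inter> I \<subseteq> J" "S \<subseteq> I.centralizer p"
      and pq: "p * q - q * p - 1 \<in> J" for S p q
  proof -
    interpret additive_superset J S by (rule S)
    show ?thesis
      by (rule I.adjoin_contract[OF J JI zero_closed add_closed S(2,3) _ inv]) (use pq JI in auto)
  qed
  \<comment> \<open>Here the properness of \<open>I\<close> enters: a nonzero scalar in
    \<open>I\<close> would be invertible and force \<open>1\<close> into \<open>I\<close>.\<close>
  have "S0 \<inter> I \<subseteq> J"
  proof
    fix a assume a: "a \<in> S0 \<inter> I"
    then obtain c j where cj: "a = scalar c + j" "j \<in> J" unfolding S0_def by blast
    then have "scalar c \<in> I" using a JI I.diff_mem[of a j] by auto
    then have "scalar (1 / c * c) \<in> I" using I.mult_left[of "scalar c" "scalar (1 / c)"] by (simp only: scalar_simps)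
    then have "c = 0" using I(3) by (cases "c = 0") (auto simp: scalar_simps)
    then show "a \<in> J" using cj by (simp add: scalar_simps)
  qed
  then have "S1 \<inter> I \<subseteq> J"
    unfolding S1_def using rel0(5) C0 by (intro contract[OF A0, of ?p0]) (simp_all add: scalar_simps)
  moreover have C1: "S1 \<subseteq> I.centralizer p" if "?q0 \<in> I.centralizer p" for p
    unfolding S1_def using C0 that by (rule I.adjoin_centralizer)
  ultimately have "S2 \<inter> I \<subseteq> J"
    unfolding S2_def using rel0(6) C by (intro contract[OF A1, of ?p1]) (simp_all add: scalar_simps)
  moreover have C2: "S2 \<subseteq> I.centralizer p" if "?q0 \<in> I.centralizer p" "?q1 \<in> I.centralizer p" for p
    unfolding S2_def using C1 that by (intro I.adjoin_centralizer)
  ultimately have "S3 \<inter> I \<subseteq> J"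
    unfolding S3_def using rel0(5) C
    by (intro contract[OF A2, of "- ?q0"]) (simp_all add: scalar_simps algebra_simps)
  moreover have "S3 \<subseteq> I.centralizer (- ?q1)"
    unfolding S3_def using C C2 by (intro I.adjoin_centralizer)
  ultimately have "S4 \<inter> I \<subseteq> J"
    unfolding S4_def using rel0(6)
    by (intro contract[OF A3, of "- ?q1"]) (simp_all add: scalar_simps algebra_simps)
  then show ?thesis
    using S4_UNIV unfolding J_def by blast
qed

section \<open>Commutation rules in the double\<close>

text \<open>\<open>H\<close> stands for the scalar \<open>1 / 2\<close>: in a bare ring it is
  described as a central element whose double is \<open>1\<close>, so the computations need no
  scalar action.\<close>

locale jordan_relations_hold =
  fixes u v \<zeta> g g' x y H :: "'a::ring_1"
  assumes H_central: "a * H = H * a" and H_double: "H + H = 1"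
    and gg': "g * g' = 1" and g'g: "g' * g = 1"
    and zeta_g: "\<zeta> * g = g * \<zeta>"
    and g_x: "g * x = x * g"
    and g_y: "g * y = y * g + x * g"
    and zeta_y: "\<zeta> * y = y * \<zeta> + y"
    and zeta_x: "\<zeta> * x = x * \<zeta> + x"
    and u_g: "u * g = g * u"
    and v_g: "v * g = g * v + g * u"
    and v_zeta: "v * \<zeta> = \<zeta> * v + v"
    and u_zeta: "u * \<zeta> = \<zeta> * u + u"
    and y_x: "y * x = x * y - H * x ^ 2"
    and v_u: "v * u = u * v - H * u ^ 2"
    and u_x: "u * x = x * u"
    and v_x: "v * x = x * v + (1 - g) + x * u"
    and u_y: "u * y = y * u + (1 - g)"
    and v_y: "v * y = y * v - g * \<zeta> + y * u"
begin

text \<open>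
  Bracketing with \<open>v\<close>, \<open>y\<close> and \<open>\<zeta>\<close> acts by derivations on the commutative subalgebra generated by \<open>x\<close>, \<open>u\<close> and \<open>g\<close>.
  The only rational invariant is \<open>z\<close>, and \<open>s\<close> is the combination of \<open>v\<close>, \<open>y\<close>, \<open>\<zeta>\<close> that acts as zero; the
  factor \<open>w\<close> and the term \<open>- 2 - 2 g\<close> make it commute with \<open>y\<close> as well.
\<close>

definition w where "w = (x * u + 2 + 2 * g) * g'"
definition z where "z = w * w * g"
definition E where "E = 2 * y + x * \<zeta>"
definition s where "s = x * v + u * y - (1 - g + H * x * u) * \<zeta>"
definition \<theta> where "\<theta> = w * (s - 2 - 2 * g)"

lemma reorder: "p * q = r \<Longrightarrow> p * (q * t) = r * (t::'a)"
  by (simp add: mult.assoc[symmetric])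

text \<open>Multiply by \<open>g'\<close> on both sides. Two summands are allowed because
  conjugation by \<open>g\<close> carries \<open>y\<close> to \<open>y + x\<close>.\<close>

lemma commute_g':
  assumes "g * a = b * g + c * g"
  shows "a * g' = g' * b + g' * c"
proof -
  have "a * g' = g' * (g * a) * g'" by (simp add: mult.assoc[symmetric] g'g)
  also have "\<dots> = g' * b + g' * c" unfolding assms by (simp add: mult.assoc gg' distrib_left distrib_right)
  finally show ?thesis .
qed

lemma g'_rules: "g' * x = x * g'" "g' * u = u * g'" "\<zeta> * g' = g' * \<zeta>" "y * g' = g' * y + x * g'"
  using commute_g'[of x x 0] commute_g'[of u u 0] commute_g'[of \<zeta> \<zeta> 0] commute_g'[of y y x] g_x u_g zeta_g g_y
  by auto

text \<open>Together with the remaining \<open>base_rules\<close>, every reordering rule points to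
  the order \<open>H\<close>, \<open>x\<close>, \<open>u\<close>, then \<open>g\<close> and
  \<open>g'\<close>, then \<open>y\<close>, \<open>\<zeta>\<close>, \<open>v\<close>. The versions
  produced by \<open>reorder\<close> let the rules act inside right-nested products.\<close>

lemma normal_rules:
  "y * x = x * y - H * x * x" "y * g = g * y - x * g" "y * u = u * y - 1 + g"
  "\<zeta> * u = u * \<zeta> - u" "g * u = u * g" "v * u = u * v - H * u * u"
  "v * x = x * v + 1 - g + x * u" "v * g = u * g + g * v"
  "v * y = y * v - g * \<zeta> + u * y - 1 + g"
  using y_x v_u u_x v_x u_y v_g u_g g_y u_zeta v_y u_y by (simp_all add: algebra_simps power2_eq_square)

lemmas base_rules = normal_rules zeta_x zeta_g zeta_y g_x u_x gg' g'g g'_rules v_zeta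
  H_central[of x] H_central[of y] H_central[of u] H_central[of v] H_central[of g] H_central[of g']
  H_central[of \<zeta>]

lemmas nf = base_rules base_rules[THEN reorder] distrib_left distrib_right left_diff_distrib
  right_diff_distrib mult.assoc mult_2 mult_2_right mult_1_left mult_1_right

text \<open>Normalisation leaves a term as two separate halves; the second equation joins them
  inside a longer sorted sum.\<close>

lemma halves: "H * t + H * t = t" "H * t + (H * t + r) = t + r"
  by (simp_all add: distrib_right[symmetric] H_double add.assoc[symmetric])

lemma w_x: "w * x = x * w" and w_u: "w * u = u * w" and w_g: "w * g = g * w"
  and w_zeta: "w * \<zeta> = \<zeta> * w"
  unfolding w_def by (simp_all add: nf algebra_simps)

text \<open>Bracketing with \<open>y\<close> scales \<open>w\<close> by half of \<open>x\<close> and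
  \<open>g\<close> by \<open>- x\<close>. These contributions cancel in \<open>w * w * g\<close>,
  which explains the square in \<open>z\<close>.\<close>

lemma y_w: "y * w = w * y + H * x * w"
  unfolding w_def by (simp add: nf) (simp add: algebra_simps halves)

text \<open>The bracket of \<open>2 * y\<close> with \<open>x\<close> is \<open>- x * x\<close>, and
  that of \<open>x * \<zeta>\<close> with \<open>x\<close> is \<open>x * x\<close>.\<close>

lemma E_x: "E * x = x * E"
  unfolding E_def by (simp add: nf) (simp add: algebra_simps halves)

lemma zeta_E: "\<zeta> * E = E * \<zeta> + E"
  unfolding E_def by (simp add: nf algebra_simps)

lemma E_w: "E * w = w * E + x * w"
proof -
  have "E * w = (y * w + y * w) + x * (\<zeta> * w)"
    by (simp add: E_def mult_2 distrib_right mult.assoc)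
  also have "\<dots> = w * y + w * y + x * (w * \<zeta>) + (H * (x * w) + H * (x * w))"
    by (simp add: y_w w_zeta mult.assoc add_ac)
  also have "\<dots> = w * E + x * w"
    unfolding halves by (simp add: E_def mult_2 distrib_left w_x[THEN reorder] mult.assoc)
  finally show ?thesis .
qed

lemma s_x: "s * x = x * s" and s_g: "s * g = g * s" and s_u: "s * u = u * s"
  and s_zeta: "s * \<zeta> = \<zeta> * s"
  unfolding s_def by (simp_all add: nf) (simp_all add: algebra_simps halves)

text \<open>Up to the term \<open>x * (1 - g)\<close>, the weight of \<open>s\<close> under
  \<open>y\<close> is opposite to that of \<open>w\<close>. The shift by \<open>- 2 - 2 * g\<close>
  absorbs this term: \<open>T = s - 2 - 2 * g\<close> satisfies
  \<open>y * T = T * y - H * x * T\<close>, so \<open>w * T\<close> commutes with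
  \<open>y\<close>.\<close>

lemma y_s: "y * s = s * y - H * x * s + x * (1 - g)"
  unfolding s_def by (simp add: nf) (simp add: algebra_simps halves)


lemma theta_x: "\<theta> * x = x * \<theta>" and theta_g: "\<theta> * g = g * \<theta>"
  and theta_u: "\<theta> * u = u * \<theta>" and theta_zeta: "\<theta> * \<zeta> = \<zeta> * \<theta>"
  unfolding \<theta>_def
  by (simp_all add: algebra_simps mult_2 mult_2_right s_x s_g s_u s_zeta
      w_x[symmetric] w_g[symmetric] w_u[symmetric] w_zeta[symmetric]
      w_x[symmetric, THEN reorder] w_g[symmetric, THEN reorder] w_u[symmetric, THEN reorder]
      w_zeta[symmetric, THEN reorder] g_x zeta_g u_g)

lemma theta_y: "\<theta> * y = y * \<theta>"
proof -
  have "y * \<theta> = y * w * (s - 2 - 2 * g)" by (simp add: \<theta>_def mult.assoc)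
  also have "\<dots> = w * (y * (s - 2 - 2 * g) + H * x * (s - 2 - 2 * g))"
    by (simp add: y_w distrib_left distrib_right mult.assoc H_central[of w, THEN reorder]
        w_x[symmetric, THEN reorder] H_central[of w, THEN reorder, symmetric])
  also have "y * (s - 2 - 2 * g) + H * x * (s - 2 - 2 * g) = (s - 2 - 2 * g) * y"
    by (simp add: y_s right_diff_distrib distrib_left left_diff_distrib distrib_right
          mult_2 mult_2_right mult.assoc normal_rules g_x)
      (simp add: algebra_simps halves)
  finally show ?thesis by (simp add: \<theta>_def mult.assoc)
qed

lemma z_x: "z * x = x * z" and z_zeta: "z * \<zeta> = \<zeta> * z"
  unfolding z_def
  by (simp_all add: mult.assoc w_x[symmetric] w_g[symmetric] w_u[symmetric] w_zeta[symmetric]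
      w_x[symmetric, THEN reorder] w_g[symmetric, THEN reorder] w_u[symmetric, THEN reorder]
      w_zeta[symmetric, THEN reorder] g_x zeta_g u_g)

lemma z_y: "z * y = y * z"
proof -
  have w_H: "w * (H * t) = H * (w * t)" for t by (simp add: mult.assoc[symmetric] H_central)
  have "y * z = w * w * (y * g) + (H * x * w * w * g + H * x * w * w * g)"
    unfolding z_def
    by (simp add: mult.assoc[symmetric] y_w distrib_right)
      (simp add: mult.assoc y_w[THEN reorder] y_w distrib_left distrib_right w_H w_x[THEN reorder])
  also have "H * x * w * w * g + H * x * w * w * g = x * w * w * g"
    by (simp add: mult.assoc halves)
  also have "\<dots> = w * w * (x * g)"
    by (simp add: mult.assoc w_x[symmetric] w_x[symmetric, THEN reorder])
  finally show ?thesis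
    unfolding z_def by (simp add: g_y distrib_left mult.assoc)
qed

lemma z_w: "z * w = w * z"
  unfolding z_def by (simp add: mult.assoc w_g[symmetric] w_g[symmetric, THEN reorder])

lemma w_theta: "\<theta> * w = w * \<theta>"
proof -
  have "\<theta> * g' = g' * \<theta>" using commute_g'[of \<theta> \<theta> 0] theta_g by simp
  then show ?thesis
    unfolding w_def[unfolded mult_2]
    by (simp add: distrib_left distrib_right mult.assoc mult_2 theta_x[THEN reorder] theta_u theta_x
       theta_u[THEN reorder] theta_g theta_g[THEN reorder])
qed

lemma z_theta: "z * \<theta> = \<theta> * z"
  unfolding z_def by (simp add: mult.assoc theta_g[symmetric] w_theta[symmetric] w_theta[symmetric, THEN reorder])

lemma E_z: "E * z = z * E" and E_theta: "E * \<theta> = \<theta> * E"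
  unfolding E_def
  by (simp_all add: distrib_left distrib_right mult_2 mult.assoc z_y theta_y z_zeta theta_zeta
      z_x[THEN reorder] theta_x[THEN reorder])

text \<open>This equation and the next two form a triangular system: once \<open>w\<close> and
  \<open>x\<close> are invertible they determine \<open>g\<close>, then \<open>u\<close>, then
  \<open>v\<close>.\<close>

lemma g_from_w: "w * w * g = z"
  by (simp add: z_def)

lemma u_from_w: "x * u = w * g - 2 - 2 * g"
  by (simp add: w_def mult.assoc g'g)

lemma v_from_theta: "w * (x * v) = \<theta> - w * (u * y - (1 - g + H * x * u) * \<zeta> - 2 - 2 * g)"
  by (simp add: \<theta>_def s_def algebra_simps)

end

section \<open>A representation by difference operators\<close>

text \<open>The simplicity proof over rational functions divides by positive integers, and the
  operators below divide by two.\<close>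

instance fract :: ("{idom,ring_char_0}") field_char_0
proof
  show "inj (of_nat :: nat \<Rightarrow> 'a fract)"
    by (auto simp: inj_def of_nat_fract eq_fract)
qed

text \<open>Additivity is what distributivity of composition over sums requires; scalars act as
  operators of their own.\<close>

definition operator_ring :: "((int \<Rightarrow> int \<Rightarrow> 'K::field) \<Rightarrow> int \<Rightarrow> int \<Rightarrow> 'K) ring" where
  "operator_ring = \<lparr> carrier = {f. \<forall>m n. f (\<lambda>a b. m a b + n a b) = (\<lambda>a b. f m a b + f n a b)},
    monoid.mult = (\<circ>), one = id, ring.zero = (\<lambda>m a b. 0), add = (\<lambda>f h m a b. f m a b + h m a b) \<rparr>"

lemma operator_ring_simps [simp]:
  "f \<in> carrier operator_ring \<longleftrightarrow> (\<forall>m n. f (\<lambda>a b. m a b + n a b) = (\<lambda>a b. f m a b + f n a b))"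
  "f \<otimes>\<^bsub>operator_ring\<^esub> h = (\<lambda>m. f (h m))" "\<one>\<^bsub>operator_ring\<^esub> = (\<lambda>m. m)"
  "\<zero>\<^bsub>operator_ring\<^esub> = (\<lambda>m a b. 0)"
  "f \<oplus>\<^bsub>operator_ring\<^esub> h = (\<lambda>m a b. f m a b + h m a b)"
  by (auto simp: operator_ring_def fun_eq_iff)

lemma operator_ring: "ring operator_ring"
proof (rule ringI)
  show "abelian_group operator_ring"
  proof (rule abelian_groupI)
    fix f :: "(int \<Rightarrow> int \<Rightarrow> 'K::field) \<Rightarrow> int \<Rightarrow> int \<Rightarrow> 'K"
    assume "f \<in> carrier operator_ring"
    then have "(\<lambda>m a b. - f m a b) \<in> carrier operator_ring" by simp
    then show "\<exists>h\<in>carrier operator_ring. h \<oplus>\<^bsub>operator_ring\<^esub> f = \<zero>\<^bsub>operator_ring\<^esub>"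
      by (rule bexI[rotated]) simp
  qed (auto simp: add_ac)
  show "Group.monoid operator_ring"
    by (rule monoidI) auto
qed auto

text \<open>
  Here \<open>m a b\<close> is the coefficient of \<open>x\<^sup>a w\<^sup>b\<close> in a formal series.  The generators \<open>x\<close> and \<open>\<zeta>\<close> act as
  multiplication by \<open>x\<close> and as \<open>x \<partial>/\<partial>x\<close>, and \<open>y\<close> as \<open>(x / 2) (w \<partial>/\<partial>w - x \<partial>/\<partial>x)\<close>; the other operators are
  then forced by letting \<open>w\<close> act as multiplication by \<open>w\<close> and the central elements as the scalars \<open>z\<close> and \<open>t\<close>.
\<close>

definition jordan_operator ::
    "'K::field_char_0 \<Rightarrow> 'K \<Rightarrow> jordan_gen \<Rightarrow> (int \<Rightarrow> int \<Rightarrow> 'K) \<Rightarrow> int \<Rightarrow> int \<Rightarrow> 'K" where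
  "jordan_operator z t gn m a b = (case gn of
      Gen_x \<Rightarrow> m (a - 1) b
    | Gen_g \<Rightarrow> z * m a (b + 2)
    | Gen_g_inv \<Rightarrow> m a (b - 2) / z
    | Gen_zeta \<Rightarrow> of_int a * m a b
    | Gen_y \<Rightarrow> of_int (b - a + 1) / 2 * m (a - 1) b
    | Gen_u \<Rightarrow> z * m (a + 1) (b + 1) - 2 * m (a + 1) b - 2 * z * m (a + 1) (b + 2)
    | Gen_v \<Rightarrow> (t + of_int (2 * a - b + 1) / 2 * z) * m (a + 1) (b + 1)
        + of_int (1 + b - a) * m (a + 1) b + of_int (1 + b - 3 * a) * z * m (a + 1) (b + 2))"

lemma rat_const_hom:
  "rat_const (c + d) = rat_const c + rat_const d" "rat_const (c * d) = rat_const c * rat_const d"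
  "rat_const 1 = 1"
  by (simp_all add: rat_const_def Poly_Mapping.single_add Poly_Mapping.mult_single One_fract_def)

lemma rat_const_half: "rat_const (1 / 2 :: 'k::field_char_0) = 1 / 2"
proof -
  have "rat_const (1 / 2 :: 'k) + rat_const (1 / 2) = 1"
    by (simp add: rat_const_hom[symmetric])
  then have "2 * rat_const (1 / 2 :: 'k) = 1" by (simp only: mult_2)
  then show ?thesis by (simp add: field_simps)
qed

lemma (in type_hom) kernel_type_ideal: "type_ideal {a. h a = \<zero>}"
  by unfold_locales (auto simp: hom_simps)

lemma jordan_representation:
  fixes z t :: "('s::linorder, 'k::field_char_0) rational_functions"
  assumes z: "z \<noteq> 0"
  obtains \<rho> :: "(jordan_gen, 'k) free_algebra
      \<Rightarrow> (int \<Rightarrow> int \<Rightarrow> ('s, 'k) rational_functions) \<Rightarrow> int \<Rightarrow> int \<Rightarrow> ('s, 'k) rational_functions"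
  where "\<rho> \<in> ring_hom type_ring operator_ring"
    and "\<And>gn. \<rho> (gen gn) = jordan_operator z t gn"
    and "\<And>c. \<rho> (scalar c) = (\<lambda>m a b. rat_const c * m a b)"
    and "\<And>r. r \<in> relation_ideal jordan_relations \<Longrightarrow> \<rho> r = \<zero>\<^bsub>operator_ring\<^esub>"
proof -
  obtain \<rho> :: "(jordan_gen, 'k) free_algebra
      \<Rightarrow> (int \<Rightarrow> int \<Rightarrow> ('s, 'k) rational_functions) \<Rightarrow> int \<Rightarrow> int \<Rightarrow> ('s, 'k) rational_functions"
    where \<rho>: "\<rho> \<in> ring_hom type_ring operator_ring"
      "\<And>gn. \<rho> (gen gn) = jordan_operator z t gn"
      "\<And>c. \<rho> (scalar c) = (\<lambda>m a b. rat_const c * m a b)"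
  proof (rule ring.free_algebra_hom[OF operator_ring, where \<gamma> = "jordan_operator z t"
        and \<sigma> = "\<lambda>c m a b. rat_const c * m a b"])
    show "(\<lambda>c m a b. rat_const c * m a b :: ('s, 'k) rational_functions) \<in> ring_hom type_ring operator_ring"
      by (auto simp: type_ring_hom_iff rat_const_hom algebra_simps fun_eq_iff)
    show "jordan_operator z t gn \<in> carrier operator_ring" for gn
      using z by (cases gn) (simp_all add: fun_eq_iff jordan_operator_def field_simps)
    show "(\<lambda>m a b. rat_const c * m a b) \<otimes>\<^bsub>operator_ring\<^esub> jordan_operator z t gn =
        jordan_operator z t gn \<otimes>\<^bsub>operator_ring\<^esub> (\<lambda>m a b. rat_const c * m a b)" for c gn
      by (cases gn) (simp_all add: fun_eq_iff jordan_operator_def algebra_simps)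
  qed blast
  interpret \<rho>: type_hom operator_ring \<rho>
    by (intro type_hom.intro type_hom_axioms.intro operator_ring \<rho>(1))
  have diff: "\<rho> (p - q) m a b = \<rho> p m a b - \<rho> q m a b" for p q m a b
    using \<rho>.hom_add[of "p - q" q] by (simp add: fun_eq_iff)
  \<comment> \<open>Each relation is compared coefficient by coefficient. The assumption
    \<open>z \<noteq> 0\<close> makes the operators of \<open>Gen_g\<close> and
    \<open>Gen_g_inv\<close> mutually inverse.\<close>
  have "\<rho> p = \<rho> q" if "(p, q) \<in> jordan_relations" for p q
    using that z unfolding jordan_relations_def Let_def insert_iff prod.inject empty_iff
    by (elim disjE)
      (simp_all add: diff \<rho>.hom_mult \<rho>.hom_add \<rho>.hom_one power2_eq_square \<rho> rat_const_half
        fun_eq_iff, simp_all add: jordan_operator_def, simp_all add: field_simps)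
  then have "relation_ideal jordan_relations \<subseteq> {r. \<rho> r = \<zero>\<^bsub>operator_ring\<^esub>}"
    using \<rho>.hom_eq_iff by (intro relation_ideal_minimal \<rho>.kernel_type_ideal) blast
  then show ?thesis
    by (intro that[OF \<rho>]) auto
qed

interpretation jordan: type_ideal "relation_ideal jordan_relations"
  by (rule relation_ideal_type_ideal)

text \<open>The identity operator on a nonzero space is not zero, so the presentation does not
  collapse. The class \<open>ring_1\<close> demands this of the quotient type below, which is why
  the representation comes before it.\<close>

lemma one_notin_jordan_relation_ideal:
  "1 \<notin> relation_ideal (jordan_relations :: ((jordan_gen, 'k::field_char_0) free_algebra \<times> _) set)"
proof
  assume one: "1 \<in> relation_ideal (jordan_relations :: ((jordan_gen, 'k) free_algebra \<times> _) set)"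
  obtain \<rho> :: "(jordan_gen, 'k) free_algebra
      \<Rightarrow> (int \<Rightarrow> int \<Rightarrow> (2, 'k) rational_functions) \<Rightarrow> int \<Rightarrow> int \<Rightarrow> (2, 'k) rational_functions"
    where \<rho>: "\<rho> \<in> ring_hom type_ring operator_ring"
    "\<And>r. r \<in> relation_ideal jordan_relations \<Longrightarrow> \<rho> r = \<zero>\<^bsub>operator_ring\<^esub>"
    using jordan_representation[of 1 0] by (metis zero_neq_one)
  then have "\<rho> 1 = \<one>\<^bsub>operator_ring\<^esub>" by (simp add: type_ring_hom_iff)
  with \<rho>(2)[OF one] have "(\<lambda>_ _. 0) = (m :: int \<Rightarrow> int \<Rightarrow> (2, 'k) rational_functions)" for m
    by (simp add: fun_eq_iff)
  from this[of "\<lambda>_ _. 1"] show False by (simp add: fun_eq_iff)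
qed

section \<open>The double as a ring type\<close>

definition jordan_eq :: "(jordan_gen, 'k::field_char_0) free_algebra \<Rightarrow> (jordan_gen, 'k) free_algebra \<Rightarrow> bool" where
  "jordan_eq a b \<longleftrightarrow> a - b \<in> relation_ideal jordan_relations"

lemma equivp_jordan_eq: "equivp (jordan_eq :: (jordan_gen, 'k::field_char_0) free_algebra \<Rightarrow> _)"
proof (rule equivpI)
  show "reflp jordan_eq"
    by (rule reflpI) (simp add: jordan_eq_def jordan.zero_mem)
  show "symp jordan_eq"
    by (rule sympI) (metis jordan_eq_def jordan.uminus_mem minus_diff_eq)
  show "transp (jordan_eq :: (jordan_gen, 'k) free_algebra \<Rightarrow> _)"
  proof (rule transpI)
    fix a b c :: "(jordan_gen, 'k) free_algebra"
    assume "jordan_eq a b" "jordan_eq b c"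
    then show "jordan_eq a c"
      using jordan.add_mem[of "a - b" "b - c"] by (simp add: jordan_eq_def)
  qed
qed

quotient_type (overloaded) 'k jordan_algebra = "(jordan_gen, 'k::field_char_0) free_algebra" / jordan_eq
  by (rule equivp_jordan_eq)

instantiation jordan_algebra :: (field_char_0) ring_1
begin

lift_definition zero_jordan_algebra :: "'a jordan_algebra" is 0 .
lift_definition one_jordan_algebra :: "'a jordan_algebra" is 1 .
lift_definition plus_jordan_algebra :: "'a jordan_algebra \<Rightarrow> 'a jordan_algebra \<Rightarrow> 'a jordan_algebra" is "(+)"
proof -
  fix a b c d :: "(jordan_gen, 'a) free_algebra"
  assume "jordan_eq a b" "jordan_eq c d"
  moreover have "a + c - (b + d) = (a - b) + (c - d)" by simp
  ultimately show "jordan_eq (a + c) (b + d)"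
    unfolding jordan_eq_def by (simp only: jordan.add_mem)
qed
lift_definition uminus_jordan_algebra :: "'a jordan_algebra \<Rightarrow> 'a jordan_algebra" is uminus
proof -
  fix a b :: "(jordan_gen, 'a) free_algebra"
  assume "jordan_eq a b"
  moreover have "- a - - b = - (a - b)" by simp
  ultimately show "jordan_eq (- a) (- b)"
    unfolding jordan_eq_def by (simp only: jordan.uminus_mem)
qed
lift_definition minus_jordan_algebra :: "'a jordan_algebra \<Rightarrow> 'a jordan_algebra \<Rightarrow> 'a jordan_algebra" is "(-)"
proof -
  fix a b c d :: "(jordan_gen, 'a) free_algebra"
  assume "jordan_eq a b" "jordan_eq c d"
  moreover have "a - c - (b - d) = (a - b) - (c - d)" by simp
  ultimately show "jordan_eq (a - c) (b - d)"
    unfolding jordan_eq_def by (simp only: jordan.diff_mem)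
qed
lift_definition times_jordan_algebra :: "'a jordan_algebra \<Rightarrow> 'a jordan_algebra \<Rightarrow> 'a jordan_algebra" is "(*)"
proof -
  fix a b c d :: "(jordan_gen, 'a) free_algebra"
  assume "jordan_eq a b" "jordan_eq c d"
  moreover have "a * c - b * d = (a - b) * c + b * (c - d)" by (simp add: algebra_simps)
  ultimately show "jordan_eq (a * c) (b * d)"
    unfolding jordan_eq_def by (simp only: jordan.add_mem jordan.mult_left jordan.mult_right)
qed

instance
proof
  show "0 \<noteq> (1 :: 'a jordan_algebra)"
  proof transfer
    show "\<not> jordan_eq 0 (1 :: (jordan_gen, 'a) free_algebra)"
      using jordan.uminus_mem[of "- 1"] one_notin_jordan_relation_ideal by (auto simp: jordan_eq_def)
  qed
qed (transfer; simp add: jordan_eq_def algebra_simps jordan.zero_mem)+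

end

lemma abs_jordan_eq_iff: "abs_jordan_algebra a = abs_jordan_algebra b \<longleftrightarrow> a - b \<in> relation_ideal jordan_relations"
  by (simp add: jordan_algebra.abs_eq_iff jordan_eq_def)

lemma abs_jordan_simps:
  "abs_jordan_algebra (a + b) = abs_jordan_algebra a + abs_jordan_algebra b"
  "abs_jordan_algebra (a - b) = abs_jordan_algebra a - abs_jordan_algebra b"
  "abs_jordan_algebra (a * b) = abs_jordan_algebra a * abs_jordan_algebra b"
  "abs_jordan_algebra 1 = 1" "abs_jordan_algebra 0 = 0"
  by (simp_all add: plus_jordan_algebra.abs_eq times_jordan_algebra.abs_eq one_jordan_algebra.abs_eq
      minus_jordan_algebra.abs_eq zero_jordan_algebra.abs_eq)

lemma jordan_algebra_hom:
  fixes h :: "(jordan_gen, 'k::field_char_0) free_algebra \<Rightarrow> 'r"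
  assumes "ring R" "h \<in> ring_hom type_ring R"
    and "\<And>r. r \<in> relation_ideal jordan_relations \<Longrightarrow> h r = \<zero>\<^bsub>R\<^esub>"
  obtains h' where "h' \<in> ring_hom type_ring R" "\<And>a. h' (abs_jordan_algebra a) = h a"
proof -
  interpret type_hom R h by (intro type_hom.intro type_hom_axioms.intro assms)
  define h' where "h' d = h (rep_jordan_algebra d)" for d
  have h': "h' (abs_jordan_algebra a) = h a" for a
    unfolding h'_def hom_eq_iff
    by (rule assms(3)) (metis Quotient3_jordan_algebra Quotient3_abs_rep abs_jordan_eq_iff)
  moreover have "h' \<in> ring_hom type_ring R"
    unfolding type_ring_hom_iff
  proof (intro conjI allI)
    fix a b :: "'k jordan_algebra"
    obtain p q where "a = abs_jordan_algebra p" "b = abs_jordan_algebra q"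
      by (metis Quotient3_jordan_algebra Quotient3_abs_rep)
    then show "h' (a * b) = h' a \<otimes>\<^bsub>R\<^esub> h' b" "h' (a + b) = h' a \<oplus>\<^bsub>R\<^esub> h' b" "h' a \<in> carrier R"
      by (simp_all add: abs_jordan_simps(1,3)[symmetric] h' hom_mult hom_add)
  next
    show "h' 1 = \<one>\<^bsub>R\<^esub>" by (simp add: abs_jordan_simps(4)[symmetric] h' hom_one del: abs_jordan_simps)
  qed
  ultimately show ?thesis using that by blast
qed

section \<open>Presented algebras inside their skew fields of fractions\<close>

lemma presented_class_eq_zero_iff:
  "presented_class Rel a = \<zero>\<^bsub>presented_algebra Rel\<^esub> \<longleftrightarrow> a \<in> relation_ideal Rel"
proof -
  interpret I: ideal "relation_ideal Rel" type_ring by (rule relation_ideal_ideal)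
  show ?thesis
    unfolding presented_class_def presented_algebra_def FactRing_def
    using I.rcos_const_imp_mem[of a] I.a_rcos_const[of a] by auto
qed

lemma presented_class_surj: "carrier (presented_algebra Rel) = range (presented_class Rel)"
  by (auto simp: presented_algebra_def FactRing_def A_RCOSETS_def' presented_class_def)

text \<open>Moves the hypotheses from cosets to the free algebra, in the form in which
  \<open>fraction_extension\<close> takes them.\<close>

lemma presented_fractions:
  assumes "skew_field_of_fractions (presented_algebra Rel) Q \<iota>"
  shows "type_hom Q (\<lambda>a. \<iota> (presented_class Rel a))"
    and "\<iota> (presented_class Rel a) = \<zero>\<^bsub>Q\<^esub> \<longleftrightarrow> a \<in> relation_ideal Rel"
    and "q \<in> carrier Q \<Longrightarrow> \<exists>a b. \<iota> (presented_class Rel b) \<noteq> \<zero>\<^bsub>Q\<^esub> \<and>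
      q \<otimes>\<^bsub>Q\<^esub> \<iota> (presented_class Rel b) = \<iota> (presented_class Rel a)"
proof -
  interpret F: skew_field_of_fractions "presented_algebra Rel" Q \<iota> by (rule assms)
  have "(\<iota> \<circ> presented_class Rel) \<in> ring_hom type_ring Q"
    by (rule ring_hom_trans[OF presented_class_hom F.embedding_hom])
  then show hom: "type_hom Q (\<lambda>a. \<iota> (presented_class Rel a))"
    by (intro type_hom.intro type_hom_axioms.intro F.Q.ring_axioms) (simp add: comp_def)
  interpret h: type_hom Q "\<lambda>a. \<iota> (presented_class Rel a)" by (rule hom)
  have closed: "presented_class Rel a \<in> carrier (presented_algebra Rel)" for a
    by (simp add: presented_class_surj)
  have zero: "\<iota> \<zero>\<^bsub>presented_algebra Rel\<^esub> = \<zero>\<^bsub>Q\<^esub>"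
    using F.embedding_hom F.R.ring_axioms F.Q.ring_axioms by (rule ring_hom_zero)
  have zero_iff: "\<iota> c = \<zero>\<^bsub>Q\<^esub> \<longleftrightarrow> c = \<zero>\<^bsub>presented_algebra Rel\<^esub>" if "c \<in> carrier (presented_algebra Rel)" for c
    using F.embedding_inj that zero F.R.zero_closed unfolding inj_on_def by metis
  show "\<iota> (presented_class Rel a) = \<zero>\<^bsub>Q\<^esub> \<longleftrightarrow> a \<in> relation_ideal Rel"
    using zero_iff[OF closed] presented_class_eq_zero_iff by blast
  assume "q \<in> carrier Q"
  then obtain c d where cd: "c \<in> carrier (presented_algebra Rel)" "d \<in> carrier (presented_algebra Rel)"
      "d \<noteq> \<zero>\<^bsub>presented_algebra Rel\<^esub>" and q: "q = \<iota> c \<otimes>\<^bsub>Q\<^esub> inv\<^bsub>Q\<^esub> \<iota> d"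
    using F.fraction by blast
  then obtain a b where ab: "c = presented_class Rel a" "d = presented_class Rel b"
    unfolding presented_class_surj by blast
  have b: "\<iota> (presented_class Rel b) \<noteq> \<zero>\<^bsub>Q\<^esub>" using cd zero_iff ab by blast
  then have "\<iota> (presented_class Rel b) \<in> Units Q" using F.Q.unitI h.closed by blast
  then have "q \<otimes>\<^bsub>Q\<^esub> \<iota> (presented_class Rel b) = \<iota> (presented_class Rel a)"
    unfolding q ab using h.closed by (simp add: F.Q.m_assoc)
  then show "\<exists>a b. \<iota> (presented_class Rel b) \<noteq> \<zero>\<^bsub>Q\<^esub> \<and>
      q \<otimes>\<^bsub>Q\<^esub> \<iota> (presented_class Rel b) = \<iota> (presented_class Rel a)"
    using b by blast
qed

abbreviation jgen :: "jordan_gen \<Rightarrow> 'k::field_char_0 jordan_algebra" where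
  "jgen gn \<equiv> abs_jordan_algebra (gen gn)"

abbreviation jscal :: "'k::field_char_0 \<Rightarrow> 'k jordan_algebra" where
  "jscal c \<equiv> abs_jordan_algebra (scalar c)"

lemma jordan_algebra_cases: obtains p where "a = abs_jordan_algebra p"
  by (metis Quotient3_jordan_algebra Quotient3_abs_rep)

lemma jscal_central: "jscal c * a = a * jscal c"
  by (rule jordan_algebra_cases[of a]) (simp add: abs_jordan_simps(3)[symmetric] scalar_central)

lemma jscal_simps:
  "jscal (c + d) = jscal c + jscal d" "jscal (c * d) = jscal c * jscal d" "jscal 1 = 1"
  by (simp_all add: scalar_simps abs_jordan_simps)

lemma jordan_relation: "(a, b) \<in> jordan_relations \<Longrightarrow> abs_jordan_algebra a = abs_jordan_algebra b"
  using relation_ideal_self by (simp add: abs_jordan_eq_iff)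

interpretation D: jordan_relations_hold "jgen Gen_u" "jgen Gen_v" "jgen Gen_zeta" "jgen Gen_g"
  "jgen Gen_g_inv" "jgen Gen_x" "jgen Gen_y" "jscal (1 / 2) :: 'k::field_char_0 jordan_algebra"
proof
  show "a * jscal (1 / 2) = jscal (1 / 2) * a" for a :: "'k jordan_algebra"
    by (simp add: jscal_central)
  show "jscal (1 / 2) + jscal (1 / 2) = (1 :: 'k jordan_algebra)"
    by (simp add: jscal_simps[symmetric])
qed (unfold abs_jordan_simps[symmetric] power2_eq_square, unfold power2_eq_square[symmetric],
    (rule jordan_relation, unfold jordan_relations_def Let_def, (rule insertI1 | rule insertI2)+)+)

text \<open>The operators were obtained by solving the formulas for \<open>w\<close>,
  \<open>z\<close> and \<theta>; this evaluates the formulas again and returns the prescribed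
  actions.\<close>

lemma jordan_algebra_representation:
  fixes z t :: "('s::linorder, 'k::field_char_0) rational_functions"
  assumes z: "z \<noteq> 0"
  obtains \<rho> :: "'k jordan_algebra
      \<Rightarrow> (int \<Rightarrow> int \<Rightarrow> ('s, 'k) rational_functions) \<Rightarrow> int \<Rightarrow> int \<Rightarrow> ('s, 'k) rational_functions"
  where "\<rho> \<in> ring_hom type_ring operator_ring"
    and "\<And>c. \<rho> (jscal c) = (\<lambda>m a b. rat_const c * m a b)"
    and "\<rho> (jgen Gen_x) = (\<lambda>m a b. m (a - 1) b)"
    and "\<rho> D.w = (\<lambda>m a b. m a (b - 1))"
    and "\<rho> D.z = (\<lambda>m a b. z * m a b)"
    and "\<rho> D.\<theta> = (\<lambda>m a b. t * m a b)"
proof -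
  obtain \<rho>0 :: "(jordan_gen, 'k) free_algebra
      \<Rightarrow> (int \<Rightarrow> int \<Rightarrow> ('s, 'k) rational_functions) \<Rightarrow> int \<Rightarrow> int \<Rightarrow> ('s, 'k) rational_functions"
    where \<rho>0: "\<rho>0 \<in> ring_hom type_ring operator_ring"
    "\<And>gn. \<rho>0 (gen gn) = jordan_operator z t gn"
    "\<And>c. \<rho>0 (scalar c) = (\<lambda>m a b. rat_const c * m a b)"
    "\<And>r. r \<in> relation_ideal jordan_relations \<Longrightarrow> \<rho>0 r = \<zero>\<^bsub>operator_ring\<^esub>"
    using jordan_representation[OF z, where t = t] by blast
  obtain \<rho> :: "'k jordan_algebra
      \<Rightarrow> (int \<Rightarrow> int \<Rightarrow> ('s, 'k) rational_functions) \<Rightarrow> int \<Rightarrow> int \<Rightarrow> ('s, 'k) rational_functions"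
    where hom: "\<rho> \<in> ring_hom type_ring operator_ring" and \<rho>: "\<And>a. \<rho> (abs_jordan_algebra a) = \<rho>0 a"
    using jordan_algebra_hom[OF operator_ring \<rho>0(1,4)] by blast
  interpret \<rho>: type_hom operator_ring \<rho>
    by (intro type_hom.intro type_hom_axioms.intro operator_ring hom)
  have diff: "\<rho> (p - q) = (\<lambda>m a b. \<rho> p m a b - \<rho> q m a b)" for p q
    using \<rho>.hom_add[of "p - q" q] by (simp add: fun_eq_iff)
  have two: "\<rho> 2 = (\<lambda>m a b. 2 * m a b)"
    unfolding one_add_one[symmetric] \<rho>.hom_add \<rho>.hom_one by (simp add: fun_eq_iff)
  note simps = \<rho>.hom_mult \<rho>.hom_add \<rho>.hom_one diff two \<rho> \<rho>0(2,3) rat_const_half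
  have w: "\<rho> D.w = (\<lambda>m a b. m a (b - 1))"
    unfolding D.w_def using z
    by (simp add: simps fun_eq_iff, simp add: jordan_operator_def)
  have z': "\<rho> D.z = (\<lambda>m a b. z * m a b)"
    unfolding D.z_def by (simp add: simps w fun_eq_iff, simp add: jordan_operator_def)
  have \<theta>: "\<rho> D.\<theta> = (\<lambda>m a b. t * m a b)"
    unfolding D.\<theta>_def D.s_def using z
    by (simp add: simps w fun_eq_iff, simp add: jordan_operator_def, simp add: field_simps)
  show ?thesis
    by (rule that[OF hom _ _ w z' \<theta>]) (simp_all add: simps jordan_operator_def fun_eq_iff)
qed

section \<open>Algebraic independence of the central elements\<close>

lemma Fract_1_hom: "(\<lambda>p. Fract p 1) \<in> ring_hom type_ring type_ring"
  by (simp add: type_ring_hom_iff One_fract_def)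

lemma rational_function_single:
  fixes c :: "'k::field"
  shows "Fract (Poly_Mapping.single m c) 1 =
    rat_const c * (Fract (Poly_Mapping.single (Poly_Mapping.single 0 1) 1) 1 ^ Poly_Mapping.lookup m 0 *
      Fract (Poly_Mapping.single (Poly_Mapping.single 1 1) 1) 1 ^ Poly_Mapping.lookup m (1 :: 2))"
proof -
  define V where "V = (\<lambda>i :: 2. Poly_Mapping.single (Poly_Mapping.single i (1::nat)) (1::'k))"
  have pow: "V i ^ n = Poly_Mapping.single (Poly_Mapping.single i n) 1" for i n
    by (induction n) (simp_all add: V_def Poly_Mapping.mult_single Poly_Mapping.single_add[symmetric])
  have "m = Poly_Mapping.single 0 (Poly_Mapping.lookup m 0) + Poly_Mapping.single 1 (Poly_Mapping.lookup m 1)"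
    using two_cases by (intro poly_mapping_eqI) (auto simp: lookup_add lookup_single when_def)
  then have "Poly_Mapping.single m c =
      Poly_Mapping.single 0 c * (V 0 ^ Poly_Mapping.lookup m 0 * V 1 ^ Poly_Mapping.lookup m 1)"
    unfolding pow by (simp add: Poly_Mapping.mult_single)
  moreover have "Fract p 1 ^ n = Fract (p ^ n) 1" for p :: "(2 \<Rightarrow>\<^sub>0 nat) \<Rightarrow>\<^sub>0 'k" and n
    by (induction n) (simp_all add: One_fract_def)
  ultimately show ?thesis by (simp add: rat_const_def V_def)
qed

lemma jordan_power_commute:
  assumes "a * D.z = D.z * a" "a * D.\<theta> = D.\<theta> * (a :: 'k::field_char_0 jordan_algebra)"
  shows "a * (jscal c * (D.z ^ i * D.\<theta> ^ j)) = jscal c * (D.z ^ i * D.\<theta> ^ j) * a"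
proof -
  have "a * D.z ^ i = D.z ^ i * a" "a * D.\<theta> ^ j = D.\<theta> ^ j * a"
    by (rule power_commuting_commutes[OF assms(1)[symmetric], symmetric]
        power_commuting_commutes[OF assms(2)[symmetric], symmetric])+
  then have "a * (D.z ^ i * D.\<theta> ^ j) = D.z ^ i * D.\<theta> ^ j * a"
    by (simp only: mult.assoc[symmetric]) (simp only: mult.assoc)
  then show ?thesis
    by (simp only: mult.assoc[symmetric] jscal_central[of c a, symmetric]) (simp only: mult.assoc)
qed

text \<open>Substitution of \<open>D.z\<close> and \<open>D.\<theta>\<close> for the two variables,
  with their algebraic independence as its injectivity.\<close>

lemma center_polynomials:
  obtains e :: "((2 \<Rightarrow>\<^sub>0 nat) \<Rightarrow>\<^sub>0 'k::field_char_0) \<Rightarrow> 'k jordan_algebra"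
  where "e \<in> ring_hom type_ring type_ring" and "\<And>p. e p = 0 \<Longrightarrow> p = 0"
    and "\<And>c. e (Poly_Mapping.single 0 c) = jscal c"
    and "e (Poly_Mapping.single (Poly_Mapping.single 0 1) 1) = D.z"
    and "e (Poly_Mapping.single (Poly_Mapping.single 1 1) 1) = D.\<theta>"
    and "\<And>a p. a * D.z = D.z * a \<Longrightarrow> a * D.\<theta> = D.\<theta> * a \<Longrightarrow> a * e p = e p * a"
proof -
  let ?W = "\<lambda>m :: 2 \<Rightarrow>\<^sub>0 nat. (D.z :: 'k jordan_algebra) ^ Poly_Mapping.lookup m 0 * D.\<theta> ^ Poly_Mapping.lookup m 1"
  have W_add: "?W (m + n) = ?W m * ?W n" for m n
  proof -
    have "D.\<theta> ^ j * D.z = (D.z :: 'k jordan_algebra) * D.\<theta> ^ j" for j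
      by (simp add: power_commuting_commutes D.z_theta)
    then have "D.\<theta> ^ j * D.z ^ i = (D.z :: 'k jordan_algebra) ^ i * D.\<theta> ^ j" for i j
      by (rule power_commuting_commutes[OF sym, symmetric])
    then have "D.\<theta> ^ j * ((D.z :: 'k jordan_algebra) ^ i * a) = D.z ^ i * (D.\<theta> ^ j * a)" for a i j
      by (simp only: mult.assoc[symmetric])
    then show ?thesis
      by (simp add: lookup_add power_add mult.assoc)
  qed
  have jscal_hom: "jscal \<in> ring_hom type_ring (type_ring :: 'k jordan_algebra ring)"
    by (simp add: type_ring_hom_iff jscal_simps)
  obtain e :: "((2 \<Rightarrow>\<^sub>0 nat) \<Rightarrow>\<^sub>0 'k) \<Rightarrow> 'k jordan_algebra"
    where e: "e \<in> ring_hom type_ring type_ring"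
      and e_single: "\<And>m c. e (Poly_Mapping.single m c) = jscal c * ?W m"
  proof (rule ring.monoid_algebra_hom[OF ring_of_type_algebra_ring jscal_hom, of ?W])
    show "jscal c \<otimes>\<^bsub>type_ring\<^esub> ?W m = ?W m \<otimes>\<^bsub>type_ring\<^esub> jscal c" for c m
      by (simp add: jscal_central)
  qed (use W_add in \<open>simp_all\<close>)
  have e_add: "e (p + q) = e p + e q" for p q
    using e by (simp add: type_ring_hom_iff)
  \<comment> \<open>The parameters of the representation are the two indeterminates themselves, so
    \<open>e p\<close> will act as multiplication by \<open>p\<close> and can vanish only for
    \<open>p = 0\<close>.\<close>
  define z t :: "(2, 'k) rational_functions" where
    z_def: "z = Fract (Poly_Mapping.single (Poly_Mapping.single 0 1) 1) 1" and
    t_def: "t = Fract (Poly_Mapping.single (Poly_Mapping.single 1 1) 1) 1"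
  have "Poly_Mapping.single (Poly_Mapping.single (0 :: 2) (1 :: nat)) (1 :: 'k) \<noteq> 0"
    by (metis lookup_single_eq lookup_zero zero_neq_one)
  then have "z \<noteq> 0"
    by (simp add: z_def Zero_fract_def eq_fract)
  then obtain \<rho> :: "'k jordan_algebra \<Rightarrow> (int \<Rightarrow> int \<Rightarrow> (2, 'k) rational_functions) \<Rightarrow>
      int \<Rightarrow> int \<Rightarrow> (2, 'k) rational_functions"
    where \<rho>_hom: "\<rho> \<in> ring_hom type_ring operator_ring"
      and \<rho>: "\<And>c. \<rho> (jscal c) = (\<lambda>m a b. rat_const c * m a b)"
        "\<rho> D.z = (\<lambda>m a b. z * m a b)" "\<rho> D.\<theta> = (\<lambda>m a b. t * m a b)"
    using jordan_algebra_representation[where t = t] by blast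
  interpret \<rho>: type_hom operator_ring \<rho>
    by (intro type_hom.intro type_hom_axioms.intro operator_ring \<rho>_hom)
  have pow: "\<rho> (a ^ n) = (\<lambda>m i j. c ^ n * m i j)" if "\<rho> a = (\<lambda>m i j. c * m i j)" for a c n
    by (induction n) (simp_all add: \<rho>.hom_one \<rho>.hom_mult that mult.assoc)
  have \<rho>_e: "\<rho> (e p) = (\<lambda>m a b. Fract p 1 * m a b)" for p
  proof (induction p rule: poly_mapping_single_induct)
    case (single n c)
    have "Fract (Poly_Mapping.single n c) 1 = rat_const c * (z ^ Poly_Mapping.lookup n 0 * t ^ Poly_Mapping.lookup n 1)"
      unfolding z_def t_def by (rule rational_function_single)
    then show ?case
      by (simp add: e_single \<rho>.hom_mult \<rho>(1) pow[OF \<rho>(2)] pow[OF \<rho>(3)] mult.assoc)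
  next
    case (add p q)
    have "Fract (p + q) 1 = Fract p 1 + Fract q 1" by simp
    then show ?case using add by (simp add: e_add \<rho>.hom_add distrib_right del: add_fract)
  qed
  show ?thesis
  proof (rule that[OF e])
    fix p assume ep: "e p = 0"
    have "(\<lambda>m a b. Fract p 1 * m a b) = \<rho> (e p)" by (rule \<rho>_e[symmetric])
    also have "\<dots> = (\<lambda>m a b. 0)" by (simp add: ep \<rho>.hom_zero)
    finally have "Fract p 1 * 1 = 0" by (rule fun_cong[OF fun_cong[OF fun_cong]])
    then show "p = 0" by (simp add: Zero_fract_def eq_fract)
  next
    fix a p assume a: "a * D.z = D.z * a" "a * D.\<theta> = D.\<theta> * (a :: 'k jordan_algebra)"
    show "a * e p = e p * a"
    proof (induction p rule: poly_mapping_single_induct)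
      case (single m c)
      show ?case unfolding e_single by (rule jordan_power_commute[OF a])
    qed (simp add: e_add distrib_left distrib_right)
  next
    have "(0 :: 2) \<noteq> 1" "(1 :: 2) \<noteq> 0" by (rule zero_neq_one one_neq_zero)+
    then have "Poly_Mapping.lookup (Poly_Mapping.single (0 :: 2) (1 :: nat)) 1 = 0"
        "Poly_Mapping.lookup (Poly_Mapping.single (1 :: 2) (1 :: nat)) 0 = 0"
      by (simp_all only: lookup_single_not_eq not_False_eq_True)
    then show "e (Poly_Mapping.single (Poly_Mapping.single 0 1) 1) = D.z"
      "e (Poly_Mapping.single (Poly_Mapping.single 1 1) 1) = D.\<theta>"
      unfolding e_single jscal_simps(3)
      by (simp_all only: lookup_single_eq power_0 power_one_right mult_1_left mult_1_right)
  next
    show "e (Poly_Mapping.single 0 c) = jscal c" for c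
      unfolding e_single by (simp only: lookup_zero power_0 mult_1_right)
  qed
qed

text \<open>Both elements act as shifts, which fix the series with all coefficients
  \<open>1\<close>.\<close>

lemma jordan_nonzero: "jgen Gen_x \<noteq> (0 :: 'k::field_char_0 jordan_algebra)" "D.w \<noteq> (0 :: 'k jordan_algebra)"
proof -
  obtain \<rho> :: "'k jordan_algebra \<Rightarrow> (int \<Rightarrow> int \<Rightarrow> (2, 'k) rational_functions) \<Rightarrow>
      int \<Rightarrow> int \<Rightarrow> (2, 'k) rational_functions"
    where hom: "\<rho> \<in> ring_hom type_ring operator_ring"
      and \<rho>: "\<rho> (jgen Gen_x) = (\<lambda>m a b. m (a - 1) b)" "\<rho> D.w = (\<lambda>m a b. m a (b - 1))"
    using jordan_algebra_representation[OF one_neq_zero, where t = 0] by blast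
  interpret \<rho>: type_hom operator_ring \<rho>
    by (intro type_hom.intro type_hom_axioms.intro operator_ring hom)
  have "\<rho> 0 (\<lambda>_ _. 1) 0 0 = 0" by (simp add: \<rho>.hom_zero)
  then show "jgen Gen_x \<noteq> (0 :: 'k jordan_algebra)" "D.w \<noteq> (0 :: 'k jordan_algebra)"
    using \<rho> by force+
qed

section \<open>Weyl generators in the skew field of fractions of the double\<close>

lemma type_ring_skew_field: "skew_field (type_ring :: 'K::field ring)"
proof -
  have "Units type_ring = carrier type_ring - {\<zero>\<^bsub>type_ring\<^esub> :: 'K}"
    by (rule field.field_Units) (rule field_from_type_algebra)
  then show ?thesis
    by (intro skew_field.intro skew_field_axioms.intro ring_of_type_algebra_ring) simp
qed

text \<open>Only an embedding of the double in some skew field is assumed here; that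
  \<open>Q\<close> consists of fractions of the double enters in the final surjectivity
  argument.\<close>

locale jordan_skew_field = skew_field Q + \<epsilon>: type_hom Q \<epsilon>
  for Q :: "'q ring" (structure) and \<epsilon> :: "'k::field_char_0 jordan_algebra \<Rightarrow> 'q" +
  assumes inj: "\<epsilon> a = \<zero> \<Longrightarrow> a = 0"
begin

lemma rational_functions_hom:
  obtains \<sigma> :: "(2, 'k) rational_functions \<Rightarrow> 'q"
  where "\<sigma> \<in> ring_hom type_ring Q"
    and "\<And>c. \<sigma> (rat_const c) = \<epsilon> (jscal c)"
    and "\<epsilon> D.z \<in> range \<sigma>" and "\<epsilon> D.\<theta> \<in> range \<sigma>"
    and "\<And>a c. a * D.z = D.z * a \<Longrightarrow> a * D.\<theta> = D.\<theta> * a \<Longrightarrow> \<sigma> c \<otimes> \<epsilon> a = \<epsilon> a \<otimes> \<sigma> c"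
proof -
  obtain e :: "((2 \<Rightarrow>\<^sub>0 nat) \<Rightarrow>\<^sub>0 'k) \<Rightarrow> 'k jordan_algebra"
    where e: "e \<in> ring_hom type_ring type_ring" "\<And>p. e p = 0 \<Longrightarrow> p = 0"
      "\<And>c. e (Poly_Mapping.single 0 c) = jscal c"
      "e (Poly_Mapping.single (Poly_Mapping.single 0 1) 1) = D.z"
      "e (Poly_Mapping.single (Poly_Mapping.single 1 1) 1) = D.\<theta>"
      "\<And>a p. a * D.z = D.z * a \<Longrightarrow> a * D.\<theta> = D.\<theta> * a \<Longrightarrow> a * e p = e p * a"
    using center_polynomials by blast
  have hom: "(\<lambda>p. \<epsilon> (e p)) \<in> ring_hom type_ring Q"
    using ring_hom_trans[OF e(1) \<epsilon>.hom] by (simp add: comp_def)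
  have e0: "e 0 = 0" using e(3)[of 0] by (simp add: scalar_simps abs_jordan_simps)
  have zero_iff: "Fract p 1 = 0 \<longleftrightarrow> p = 0" for p :: "(2 \<Rightarrow>\<^sub>0 nat) \<Rightarrow>\<^sub>0 'k"
    by (simp add: Zero_fract_def eq_fract)
  \<comment> \<open>Both kernels are zero: on one side polynomials embed in their fraction field, on
    the other they embed in \<open>Q\<close> by algebraic independence.\<close>
  interpret F: fraction_extension "type_ring :: (2, 'k) rational_functions ring" Q
    "\<lambda>p. Fract p 1" "\<lambda>p. \<epsilon> (e p)"
  proof (intro fraction_extension.intro fraction_extension_axioms.intro type_ring_skew_field
      skew_field_axioms type_hom.intro type_hom_axioms.intro ring_of_type_algebra_ring Fract_1_hom hom)
    show "Fract p 1 = \<zero>\<^bsub>type_ring\<^esub> \<longleftrightarrow> \<epsilon> (e p) = \<zero>" for p :: "(2 \<Rightarrow>\<^sub>0 nat) \<Rightarrow>\<^sub>0 'k"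
      using inj[of "e p"] e(2)[of p] e0 \<epsilon>.hom_zero by (auto simp: zero_iff)
  next
    fix q :: "(2, 'k) rational_functions"
    obtain a b where "q = Fract a b" "b \<noteq> 0" by (cases q)
    then show "\<exists>a b. Fract b 1 \<noteq> \<zero>\<^bsub>type_ring\<^esub> \<and> q \<otimes>\<^bsub>type_ring\<^esub> Fract b 1 = Fract a 1"
      by (intro exI[of _ a] exI[of _ b]) (simp add: zero_iff eq_fract)
  qed (rule ring_axioms)
  have comm: "F.ext c \<otimes> \<epsilon> a = \<epsilon> a \<otimes> F.ext c"
    if a: "a * D.z = D.z * a" "a * D.\<theta> = D.\<theta> * a" for a c
  proof -
    obtain p r where pr: "c = Fract p r" "r \<noteq> 0" by (cases c)
    have ext: "F.ext c \<in> carrier Q" by (rule F.ext_closed) simp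
    have r: "\<epsilon> (e r) \<noteq> \<zero>" using inj e(2) pr by blast
    have "F.ext c \<otimes> \<epsilon> (e r) = \<epsilon> (e p)"
      using pr by (intro F.ext_eqD) (simp_all add: eq_fract)
    moreover have "\<epsilon> a \<otimes> \<epsilon> (e p) = \<epsilon> (e p) \<otimes> \<epsilon> a" "\<epsilon> a \<otimes> \<epsilon> (e r) = \<epsilon> (e r) \<otimes> \<epsilon> a"
      unfolding \<epsilon>.hom_mult[symmetric] using e(6)[OF a] by simp_all
    ultimately have "F.ext c \<otimes> \<epsilon> a \<otimes> \<epsilon> (e r) = \<epsilon> a \<otimes> F.ext c \<otimes> \<epsilon> (e r)"
      using ext by (simp add: m_assoc)
        (simp add: m_assoc[symmetric])
    then show ?thesis
      by (rule right_cancel[OF _ m_closed[OF ext \<epsilon>.closed] m_closed[OF \<epsilon>.closed ext] \<epsilon>.closed r])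
  qed
  show ?thesis
  proof (rule that[OF F.ext_hom])
    show "F.ext (rat_const c) = \<epsilon> (jscal c)" for c
      unfolding rat_const_def F.ext_base e(3) by (rule refl)
    show "\<epsilon> D.z \<in> range F.ext" "\<epsilon> D.\<theta> \<in> range F.ext"
      using F.ext_base[of "Poly_Mapping.single (Poly_Mapping.single 0 1) 1", unfolded e(4)]
        F.ext_base[of "Poly_Mapping.single (Poly_Mapping.single 1 1) 1", unfolded e(5)]
      by (simp_all only: range_eqI[OF sym])
  qed (rule comm)
qed

abbreviation qX where "qX \<equiv> \<epsilon> (jgen Gen_x)"
abbreviation qZ where "qZ \<equiv> \<epsilon> (jgen Gen_zeta)"
abbreviation qW where "qW \<equiv> \<epsilon> D.w"
abbreviation P0 where "P0 \<equiv> inv qX \<otimes> qZ"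
abbreviation P1 where "P1 \<equiv> inv qW \<otimes> (inv qX \<otimes> \<epsilon> D.E)"

lemma X_nonzero: "qX \<noteq> \<zero>" and W_nonzero: "qW \<noteq> \<zero>"
  using inj jordan_nonzero by blast+

lemma X_unit: "qX \<in> Units Q" and W_unit: "qW \<in> Units Q"
  by (rule unitI[OF \<epsilon>.closed X_nonzero] unitI[OF \<epsilon>.closed W_nonzero])+

lemma inv_closed [simp]: "inv qX \<in> carrier Q" "inv qW \<in> carrier Q"
  using X_unit W_unit by simp_all

lemma cancel_simps:
  assumes "a \<in> carrier Q"
  shows "qX \<otimes> (inv qX \<otimes> a) = a" "inv qX \<otimes> (qX \<otimes> a) = a" "qW \<otimes> (inv qW \<otimes> a) = a" "inv qW \<otimes> (qW \<otimes> a) = a"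
  using X_unit W_unit assms by (simp_all add: m_assoc[symmetric])

lemma base_comm: "qX \<otimes> qW = qW \<otimes> qX" "qZ \<otimes> qW = qW \<otimes> qZ" "qW \<otimes> qZ = qZ \<otimes> qW" "\<epsilon> D.E \<otimes> qX = qX \<otimes> \<epsilon> D.E"
  by (simp_all only: \<epsilon>.hom_mult[symmetric] D.w_x D.w_zeta D.E_x)

lemma inv_comm: "inv qX \<otimes> qW = qW \<otimes> inv qX" "inv qW \<otimes> qX = qX \<otimes> inv qW" "inv qW \<otimes> qZ = qZ \<otimes> inv qW"
  by (rule commutes_inv[OF base_comm(1) \<epsilon>.closed \<epsilon>.closed X_nonzero]
      commutes_inv[OF base_comm(1)[symmetric] \<epsilon>.closed \<epsilon>.closed W_nonzero]
      commutes_inv[OF base_comm(3) \<epsilon>.closed \<epsilon>.closed W_nonzero])+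

lemma inv_X_X: "inv qX \<otimes> qX = qX \<otimes> inv qX"
  using X_unit by simp

lemma P0_X: "P0 \<otimes> qX = qX \<otimes> P0 \<oplus> \<one>"
proof -
  have "qZ \<otimes> qX = qX \<otimes> qZ \<oplus> qX"
    by (simp only: \<epsilon>.hom_mult[symmetric] \<epsilon>.hom_add[symmetric] D.zeta_x)
  then show ?thesis
    using X_unit by (simp add: m_assoc r_distr cancel_simps)
qed

lemma P0_W: "P0 \<otimes> qW = qW \<otimes> P0"
  by (rule commutes_mult[OF inv_comm(1) base_comm(2)]) simp_all

lemma T_X: "inv qX \<otimes> \<epsilon> D.E \<otimes> qX = qX \<otimes> (inv qX \<otimes> \<epsilon> D.E)"
  by (rule commutes_mult[OF inv_X_X base_comm(4)]) simp_all

lemma P1_X: "P1 \<otimes> qX = qX \<otimes> P1"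
  by (rule commutes_mult[OF inv_comm(2) T_X]) simp_all

lemma P1_W: "P1 \<otimes> qW = qW \<otimes> P1 \<oplus> \<one>"
proof -
  have 1: "\<epsilon> D.E \<otimes> qW = qW \<otimes> \<epsilon> D.E \<oplus> qX \<otimes> qW"
    by (simp only: \<epsilon>.hom_mult[symmetric] \<epsilon>.hom_add[symmetric] D.zeta_E D.E_w)
  have "inv qX \<otimes> (qW \<otimes> \<epsilon> D.E) = qW \<otimes> (inv qX \<otimes> \<epsilon> D.E)"
    by (simp add: m_assoc[symmetric] inv_comm)
  then show ?thesis
    using W_unit by (simp add: m_assoc 1 r_distr cancel_simps)
qed

text \<open>Both \<open>x\<close> and \<open>D.E\<close> have weight one under \<zeta>, so their
  quotient \<open>T\<close> has weight zero and commutes with \<open>qZ\<close>; \<open>qW\<close>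
  commutes with \<open>qZ\<close> as well, and \<open>P1\<close> with \<open>qX\<close>.\<close>

lemma P0_P1: "P0 \<otimes> P1 = P1 \<otimes> P0"
proof -
  define T where "T = inv qX \<otimes> \<epsilon> D.E"
  have T: "T \<in> carrier Q" and XT: "qX \<otimes> T = \<epsilon> D.E" by (simp_all add: T_def cancel_simps)
  have "qZ \<otimes> \<epsilon> D.E = \<epsilon> D.E \<otimes> qZ \<oplus> \<epsilon> D.E"
    by (simp only: \<epsilon>.hom_mult[symmetric] \<epsilon>.hom_add[symmetric] D.zeta_E D.E_w)
  moreover have "qZ \<otimes> qX = qX \<otimes> qZ \<oplus> qX"
    by (simp only: \<epsilon>.hom_mult[symmetric] \<epsilon>.hom_add[symmetric] D.zeta_x)
  then have "qZ \<otimes> (qX \<otimes> T) = qX \<otimes> (qZ \<otimes> T) \<oplus> qX \<otimes> T"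
    using T by (simp add: m_assoc[symmetric] l_distr)
  ultimately have "qX \<otimes> (qZ \<otimes> T) = qX \<otimes> (T \<otimes> qZ)"
    using T by (simp add: XT m_assoc[symmetric])
  then have "qZ \<otimes> T = T \<otimes> qZ" by (rule left_cancel) (use T X_nonzero in simp_all)
  then have ZP: "P1 \<otimes> qZ = qZ \<otimes> P1"
    unfolding T_def[symmetric] by (intro commutes_mult[OF inv_comm(3)]) (simp_all add: T)
  have "inv qX \<otimes> P1 = P1 \<otimes> inv qX"
    by (rule commutes_inv[OF P1_X[symmetric] _ _ X_nonzero]) simp_all
  then show ?thesis
    by (rule commutes_mult[OF _ ZP[symmetric]]) simp_all
qed

end

context jordan_skew_field
begin

lemma weyl_hom:
  obtains \<psi> :: "(2 weyl_gen, (2, 'k) rational_functions) free_algebra \<Rightarrow> 'q"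
  where "\<psi> \<in> ring_hom type_ring Q"
    and "\<And>r. \<psi> r = \<zero> \<longleftrightarrow> r \<in> relation_ideal weyl_relations"
    and "\<And>c. \<psi> (scalar (rat_const c)) = \<epsilon> (jscal c)"
    and "\<epsilon> D.z \<in> range \<psi>" and "\<epsilon> D.\<theta> \<in> range \<psi>" and "qX \<in> range \<psi>" and "qW \<in> range \<psi>"
    and "P0 \<in> range \<psi>" and "P1 \<in> range \<psi>"
proof -
  obtain \<sigma> :: "(2, 'k) rational_functions \<Rightarrow> 'q"
    where \<sigma>: "\<sigma> \<in> ring_hom type_ring Q" "\<And>c. \<sigma> (rat_const c) = \<epsilon> (jscal c)"
      "\<epsilon> D.z \<in> range \<sigma>" "\<epsilon> D.\<theta> \<in> range \<sigma>"
      and comm: "\<And>a c. a * D.z = D.z * a \<Longrightarrow> a * D.\<theta> = D.\<theta> * a \<Longrightarrow> \<sigma> c \<otimes> \<epsilon> a = \<epsilon> a \<otimes> \<sigma> c"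
    using rational_functions_hom by blast
  interpret \<sigma>: type_hom Q \<sigma> by unfold_locales (rule \<sigma>)
  define \<gamma> where "\<gamma> gn = (case gn of WQ i \<Rightarrow> if i = 0 then qX else qW | WP i \<Rightarrow> if i = 0 then P0 else P1)"
    for gn :: "2 weyl_gen"
  have \<gamma>: "\<gamma> gn \<in> carrier Q" for gn
    by (cases gn) (simp_all add: \<gamma>_def)
  \<comment> \<open>The Weyl generators are made of these four elements and inverses, so it suffices
    that the four commute with \<open>D.z\<close> and \<open>D.\<theta>\<close>.\<close>
  have base: "\<epsilon> a \<otimes> \<sigma> c = \<sigma> c \<otimes> \<epsilon> a" if "a \<in> {jgen Gen_x, jgen Gen_zeta, D.w, D.E}" for a c
    using that by (intro comm[symmetric])
      (auto simp: D.z_x D.z_zeta D.z_w D.E_z D.theta_x D.theta_zeta D.w_theta D.E_theta)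
  have inv_X: "inv qX \<otimes> \<sigma> c = \<sigma> c \<otimes> inv qX" for c
    by (rule commutes_inv[OF base \<epsilon>.closed \<sigma>.closed X_nonzero]) simp
  have inv_W: "inv qW \<otimes> \<sigma> c = \<sigma> c \<otimes> inv qW" for c
    by (rule commutes_inv[OF base \<epsilon>.closed \<sigma>.closed W_nonzero]) simp
  have P0_comm: "P0 \<otimes> \<sigma> c = \<sigma> c \<otimes> P0" for c
    by (rule commutes_mult[OF inv_X base]) simp_all
  have T_comm: "inv qX \<otimes> \<epsilon> D.E \<otimes> \<sigma> c = \<sigma> c \<otimes> (inv qX \<otimes> \<epsilon> D.E)" for c
    by (rule commutes_mult[OF inv_X base]) simp_all
  have P1_comm: "P1 \<otimes> \<sigma> c = \<sigma> c \<otimes> P1" for c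
    by (rule commutes_mult[OF inv_W T_comm]) simp_all
  have \<gamma>_comm: "\<sigma> c \<otimes> \<gamma> gn = \<gamma> gn \<otimes> \<sigma> c" for c gn
    using base[of "jgen Gen_x" c] base[of D.w c] P0_comm[of c] P1_comm[of c]
    by (cases gn) (simp_all only: \<gamma>_def weyl_gen.case insertI1 insertI2 split: if_split, blast+)
  obtain \<psi> :: "(2 weyl_gen, (2, 'k) rational_functions) free_algebra \<Rightarrow> 'q"
    where \<psi>: "\<psi> \<in> ring_hom type_ring Q" "\<And>gn. \<psi> (gen gn) = \<gamma> gn" "\<And>c. \<psi> (scalar c) = \<sigma> c"
    using free_algebra_hom[OF \<sigma>(1), of \<gamma>, OF \<gamma> \<gamma>_comm] by blast
  interpret \<psi>: type_hom Q \<psi> by unfold_locales (rule \<psi>)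
  have \<psi>_gen: "\<psi> (gen (WQ 0)) = qX" "\<psi> (gen (WQ 1)) = qW" "\<psi> (gen (WP 0)) = P0" "\<psi> (gen (WP 1)) = P1"
    unfolding \<psi>(2) \<gamma>_def by simp_all
  have minus: "a \<oplus> b \<ominus> a = b" if "a \<in> carrier Q" "b \<in> carrier Q" for a b
    using that by algebra
  have minus_self: "a \<ominus> a = \<zero>" if "a \<in> carrier Q" for a
    using that by algebra
  have "\<psi> (gen (WP i) * gen (WQ j) - gen (WQ j) * gen (WP i)) = \<psi> (if i = j then 1 else 0)" for i j
    using two_cases[of i] two_cases[of j]
    by (elim disjE) (simp_all add: \<psi>.hom_simps \<psi>_gen P0_X P0_W P1_X P1_W minus minus_self)
  moreover have "\<psi> (gen (WQ i) * gen (WQ j)) = \<psi> (gen (WQ j) * gen (WQ i))" for i j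
    using two_cases[of i] two_cases[of j]
    by (elim disjE) (simp_all add: \<psi>.hom_simps \<psi>_gen base_comm(1))
  moreover have "\<psi> (gen (WP i) * gen (WP j)) = \<psi> (gen (WP j) * gen (WP i))" for i j
    using two_cases[of i] two_cases[of j]
    by (elim disjE) (simp_all add: \<psi>.hom_simps \<psi>_gen P0_P1)
  ultimately have rel: "\<psi> a = \<psi> b" if "(a, b) \<in> weyl_relations" for a b
    using that unfolding weyl_relations_def by blast
  have sub: "relation_ideal weyl_relations \<subseteq> {r. \<psi> r = \<zero>}"
    by (rule relation_ideal_minimal[OF \<psi>.kernel_type_ideal]) (simp add: \<psi>.hom_eq_iff[symmetric] rel)
  \<comment> \<open>The kernel is proper because \<open>1\<close> is nonzero in \<open>Q\<close>;
    simplicity leaves no room beyond the relation ideal.\<close>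
  moreover have "{r. \<psi> r = \<zero>} \<subseteq> relation_ideal weyl_relations"
    by (rule weyl_algebra_simple[OF _ \<psi>.kernel_type_ideal sub]) (simp_all add: \<psi>.hom_one one_nonzero)
  ultimately have kernel: "\<psi> r = \<zero> \<longleftrightarrow> r \<in> relation_ideal weyl_relations" for r by blast
  have "range \<sigma> \<subseteq> range \<psi>" unfolding \<psi>(3)[symmetric] by blast
  then show ?thesis
    using \<sigma>(2-4) \<psi>_gen by (intro that[OF \<psi>(1) kernel]) (auto simp: \<psi>(3) intro: range_eqI[OF sym])
qed

text \<open>To be applied with \<open>M\<close> the image of \<open>L\<close>. The generators appear
  in the order \<open>\<zeta>\<close>, \<open>y\<close>, \<open>g\<close>, \<open>g'\<close>,
  \<open>u\<close>, \<open>v\<close>; from \<open>g\<close> on, each is reached by left division by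
  nonzero elements already found.\<close>

lemma generated:
  assumes M: "\<And>a b. a \<in> M \<Longrightarrow> b \<in> M \<Longrightarrow> a \<oplus> b \<in> M" "\<And>a b. a \<in> M \<Longrightarrow> b \<in> M \<Longrightarrow> a \<otimes> b \<in> M"
      "\<And>a. a \<in> M \<Longrightarrow> a \<noteq> \<zero> \<Longrightarrow> inv a \<in> M"
    and gens: "\<And>c. \<epsilon> (jscal c) \<in> M" "\<epsilon> D.z \<in> M" "\<epsilon> D.\<theta> \<in> M" "qX \<in> M" "qW \<in> M" "P0 \<in> M" "P1 \<in> M"
  shows "\<epsilon> a \<in> M"
proof -
  define N where "N = {a. \<epsilon> a \<in> M}"
  have add: "a + b \<in> N" and mult: "a * b \<in> N" if "a \<in> N" "b \<in> N" for a b
    using that M by (simp_all add: N_def \<epsilon>.hom_add \<epsilon>.hom_mult)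
  have scal: "jscal c \<in> N" for c
    using gens by (simp add: N_def)
  have one: "1 \<in> N"
    using scal[of 1] by (simp only: jscal_simps)
  \<comment> \<open>Closure under negation is not among the conditions on \<open>M\<close>; the
    scalar \<open>- 1\<close> supplies it.\<close>
  have "jscal (- 1) = (- 1 :: 'k jordan_algebra)"
    using abs_jordan_simps(2)[of 0 "1 :: (jordan_gen, 'k) free_algebra"]
    by (simp only: abs_jordan_simps(4,5) scalar_simps diff_0)
  then have minus_one: "- 1 \<in> N"
    using scal[of "- 1"] by (simp only:)
  have diff: "a - b \<in> N" if "a \<in> N" "b \<in> N" for a b
    using add[OF that(1) mult[OF minus_one that(2)]] by simp
  have divide: "c \<in> N" if "a \<in> N" "a * c \<in> N" "a \<noteq> 0" for a c
  proof -
    have "\<epsilon> a \<noteq> \<zero>" using inj that by blast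
    then have "\<epsilon> a \<in> Units Q" by (intro unitI) simp_all
    then have "\<epsilon> c = inv (\<epsilon> a) \<otimes> \<epsilon> (a * c)" by (simp add: \<epsilon>.hom_mult m_assoc[symmetric])
    moreover have "inv (\<epsilon> a) \<otimes> \<epsilon> (a * c) \<in> M"
      using that \<open>\<epsilon> a \<noteq> \<zero>\<close> M unfolding N_def by blast
    ultimately show ?thesis by (simp only: N_def mem_Collect_eq)
  qed
  have two: "2 \<in> N" using add[OF one one] by simp
  have x: "jgen Gen_x \<in> N" and w: "D.w \<in> N" and z: "D.z \<in> N" and \<theta>: "D.\<theta> \<in> N"
    using gens by (simp_all add: N_def)
  \<comment> \<open>These products undo the divisions in \<open>P0\<close> and \<open>P1\<close> and
    return \<open>qZ\<close> and \<open>\<epsilon> D.E\<close>.\<close>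
  have "qX \<otimes> P0 \<in> M" "qX \<otimes> (qW \<otimes> P1) \<in> M"
    using gens M(2) by blast+
  then have \<zeta>: "jgen Gen_zeta \<in> N" and E: "D.E \<in> N"
    by (simp_all add: N_def cancel_simps)
  have "jscal (1 / 2) * (D.E - jgen Gen_x * jgen Gen_zeta) \<in> N"
    by (intro mult diff scal E x \<zeta>)
  also have "jscal (1 / 2) * (D.E - jgen Gen_x * jgen Gen_zeta) = jgen Gen_y"
    by (simp add: D.E_def mult_2 distrib_left D.halves)
  finally have y: "jgen Gen_y \<in> N" .
  have ww: "D.w * D.w \<noteq> (0 :: 'k jordan_algebra)"
  proof
    assume "D.w * D.w = (0 :: 'k jordan_algebra)"
    then have "qW \<otimes> qW = \<zero>" using \<epsilon>.hom_zero by (simp add: \<epsilon>.hom_mult[symmetric])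
    then show False using integral[of qW qW] W_nonzero by simp
  qed
  have g: "jgen Gen_g \<in> N"
    by (rule divide[OF mult[OF w w] _ ww]) (simp only: D.g_from_w z)
  have "jgen Gen_g \<noteq> (0 :: 'k jordan_algebra)"
    using D.gg' by (metis mult_zero_left zero_neq_one)
  then have g': "jgen Gen_g_inv \<in> N"
    by (rule divide[OF g, rotated]) (simp only: D.gg' one)
  have u: "jgen Gen_u \<in> N"
    by (rule divide[OF x _ jordan_nonzero(1)]) (simp only: D.u_from_w, intro diff mult w g two)
  have "D.w * (jgen Gen_x * jgen Gen_v) \<in> N"
    unfolding D.v_from_theta by (intro diff mult add one two scal \<theta> w u y g x \<zeta>)
  then have v: "jgen Gen_v \<in> N"
    by (rule divide[OF x divide[OF w _ jordan_nonzero(2)] jordan_nonzero(1)])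
  have gen: "jgen gn \<in> N" for gn
    by (cases gn) (simp_all only: x y u v g g' \<zeta>)
  have "abs_jordan_algebra p \<in> N" for p
    by (induction p rule: free_algebra_induct) (simp_all add: abs_jordan_simps scal gen mult add)
  then show ?thesis
    by (cases a rule: jordan_algebra_cases) (simp add: N_def)
qed

end

text \<open>These are the closure conditions on \<open>M\<close> in \<open>generated\<close>;
  inverses are preserved because \<open>ext\<close> is multiplicative and unital.\<close>

lemma (in fraction_extension) ext_image_closed:
  shows "a \<in> ext ` carrier L \<Longrightarrow> b \<in> ext ` carrier L \<Longrightarrow> a \<oplus>\<^bsub>Q\<^esub> b \<in> ext ` carrier L"
    and "a \<in> ext ` carrier L \<Longrightarrow> b \<in> ext ` carrier L \<Longrightarrow> a \<otimes>\<^bsub>Q\<^esub> b \<in> ext ` carrier L"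
    and "a \<in> ext ` carrier L \<Longrightarrow> a \<noteq> \<zero>\<^bsub>Q\<^esub> \<Longrightarrow> inv\<^bsub>Q\<^esub> a \<in> ext ` carrier L"
proof -
  show "a \<oplus>\<^bsub>Q\<^esub> b \<in> ext ` carrier L" if "a \<in> ext ` carrier L" "b \<in> ext ` carrier L"
    using that by (auto simp: ext_add[symmetric])
  show "a \<otimes>\<^bsub>Q\<^esub> b \<in> ext ` carrier L" if "a \<in> ext ` carrier L" "b \<in> ext ` carrier L"
    using that by (auto simp: ext_mult[symmetric])
  assume "a \<in> ext ` carrier L" and a0: "a \<noteq> \<zero>\<^bsub>Q\<^esub>"
  then obtain q where q: "q \<in> carrier L" "a = ext q" by blast
  have "ext \<zero>\<^bsub>L\<^esub> = \<zero>\<^bsub>Q\<^esub>" using ext_base[of 0] by (simp add: h1.hom_zero h2.hom_zero)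
  then have "q \<in> Units L" using q a0 by (intro L.unitI) auto
  then have inv: "ext (inv\<^bsub>L\<^esub> q) \<otimes>\<^bsub>Q\<^esub> a = \<one>\<^bsub>Q\<^esub>" "inv\<^bsub>L\<^esub> q \<in> carrier L"
    using q ext_base[of 1] by (simp_all add: ext_mult[symmetric] h1.hom_one h2.hom_one)
  have a: "a \<in> Units Q" using q a0 ext_closed by (intro Q.unitI) auto
  have "ext (inv\<^bsub>L\<^esub> q) = inv\<^bsub>Q\<^esub> a"
    by (rule Q.right_cancel[OF trans[OF inv(1) Q.Units_l_inv[OF a, symmetric]] ext_closed[OF inv(2)]
          Q.Units_inv_closed[OF a] Q.Units_closed[OF a] a0])
  then show "inv\<^bsub>Q\<^esub> a \<in> ext ` carrier L"
    using inv(2) by (rule image_eqI[OF sym])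
qed

theorem corollary4p11:
  fixes Q :: "'q ring"
    and \<iota> :: "(jordan_gen, 'k::{alg_closed_field, field_char_0}) free_algebra set \<Rightarrow> 'q"
    and L :: "'l ring"
    and \<kappa> :: "(2 weyl_gen, (2, 'k) rational_functions) free_algebra set \<Rightarrow> 'l"
  assumes "skew_field_of_fractions jordan_double Q \<iota>"
    and "weyl_skew_field L \<kappa>"
  shows "\<exists>f \<in> ring_iso Q L. \<forall>c. f (jordan_scalar \<iota> c) = weyl_scalar \<kappa> c"
proof -
  interpret FQ: skew_field_of_fractions jordan_double Q \<iota> by (rule assms)
  interpret FL: skew_field_of_fractions weyl_algebra L \<kappa> by (rule assms)
  interpret h: type_hom Q "\<lambda>a. \<iota> (presented_class jordan_relations a)"
    by (rule presented_fractions(1)[OF assms(1)])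
  interpret l: type_hom L "\<lambda>a. \<kappa> (presented_class weyl_relations a)"
    by (rule presented_fractions(1)[OF assms(2)])
  obtain \<epsilon> :: "'k jordan_algebra \<Rightarrow> 'q" where \<epsilon>: "\<epsilon> \<in> ring_hom type_ring Q"
      and \<epsilon>_abs: "\<And>a. \<epsilon> (abs_jordan_algebra a) = \<iota> (presented_class jordan_relations a)"
    using jordan_algebra_hom[OF FQ.Q.ring_axioms h.hom] presented_fractions(2)[OF assms(1)] by blast
  interpret jordan_skew_field Q \<epsilon>
  proof (intro jordan_skew_field.intro jordan_skew_field_axioms.intro FQ.Q.skew_field_axioms
      type_hom.intro type_hom_axioms.intro FQ.Q.ring_axioms \<epsilon>)
    fix a assume "\<epsilon> a = \<zero>\<^bsub>Q\<^esub>"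
    then show "a = 0"
      by (cases a rule: jordan_algebra_cases)
        (simp add: \<epsilon>_abs presented_fractions(2)[OF assms(1)] abs_jordan_simps(5)[symmetric] abs_jordan_eq_iff
          del: abs_jordan_simps)
  qed
  obtain \<psi> :: "(2 weyl_gen, (2, 'k) rational_functions) free_algebra \<Rightarrow> 'q"
    where \<psi>: "\<psi> \<in> ring_hom type_ring Q"
      "\<And>r. \<psi> r = \<zero>\<^bsub>Q\<^esub> \<longleftrightarrow> r \<in> relation_ideal weyl_relations"
      "\<And>c. \<psi> (scalar (rat_const c)) = \<epsilon> (jscal c)"
      "\<epsilon> D.z \<in> range \<psi>" "\<epsilon> D.\<theta> \<in> range \<psi>" "qX \<in> range \<psi>" "qW \<in> range \<psi>" "P0 \<in> range \<psi>" "P1 \<in> range \<psi>"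
    using weyl_hom by blast
  \<comment> \<open>Simplicity pays off here: both maps have the Weyl relation ideal as kernel, so
    \<open>\<psi>\<close> extends to all of \<open>L\<close>.\<close>
  interpret F: fraction_extension L Q "\<lambda>a. \<kappa> (presented_class weyl_relations a)" \<psi>
  proof (rule fraction_extension.intro)
    show "skew_field L" by (rule FL.Q.skew_field_axioms)
    show "skew_field Q" by (rule FQ.Q.skew_field_axioms)
    show "type_hom L (\<lambda>a. \<kappa> (presented_class weyl_relations a))" by (rule presented_fractions(1)[OF assms(2)])
    show "type_hom Q \<psi>" by (intro type_hom.intro type_hom_axioms.intro FQ.Q.ring_axioms \<psi>(1))
    show "fraction_extension_axioms L Q (\<lambda>a. \<kappa> (presented_class weyl_relations a)) \<psi>"
      unfolding fraction_extension_axioms_def \<psi>(2) presented_fractions(2)[OF assms(2)]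
      using presented_fractions(3)[OF assms(2)] unfolding presented_fractions(2)[OF assms(2)] by blast
  qed
  have "\<psi> a \<in> F.ext ` carrier L" for a
    using imageI[OF l.closed[of a], of F.ext] by (simp only: F.ext_base)
  then have range_\<psi>: "range \<psi> \<subseteq> F.ext ` carrier L" by blast
  have \<epsilon>_image: "\<epsilon> a \<in> F.ext ` carrier L" for a
  proof (rule generated[OF F.ext_image_closed])
    show "\<epsilon> (jscal c) \<in> F.ext ` carrier L" for c
      unfolding \<psi>(3)[symmetric] using range_\<psi> by blast
  qed (use \<psi>(4-) range_\<psi> in blast)+
  \<comment> \<open>The image contains the double and is closed under products and inverses, hence
    contains every fraction.\<close>
  have "carrier Q \<subseteq> F.ext ` carrier L"
  proof
    fix q assume q: "q \<in> carrier Q"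
    then obtain a b where b: "\<epsilon> (abs_jordan_algebra b) \<noteq> \<zero>\<^bsub>Q\<^esub>"
        and a: "q \<otimes>\<^bsub>Q\<^esub> \<epsilon> (abs_jordan_algebra b) = \<epsilon> (abs_jordan_algebra a)"
      unfolding \<epsilon>_abs using presented_fractions(3)[OF assms(1)] by blast
    have "\<epsilon> (abs_jordan_algebra b) \<in> Units Q" 
      using b by (rule FQ.Q.unitI[rotated]) (simp add: \<epsilon>_abs)
    then have "q = \<epsilon> (abs_jordan_algebra a) \<otimes>\<^bsub>Q\<^esub> inv\<^bsub>Q\<^esub> \<epsilon> (abs_jordan_algebra b)"
      unfolding a[symmetric] using q by (simp add: FQ.Q.m_assoc \<epsilon>_abs)
    then show "q \<in> F.ext ` carrier L"
      using F.ext_image_closed(2)[OF \<epsilon>_image F.ext_image_closed(3)[OF \<epsilon>_image b]] by (simp only:)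
  qed
  then have "bij_betw F.ext (carrier L) (carrier Q)"
    using F.ext_inj F.ext_closed by (auto simp: bij_betw_def)
  then have iso: "F.ext \<in> ring_iso L Q"
    using F.ext_hom by (simp add: ring_iso_def)
  \<comment> \<open>Compatibility with the ground field is checked for \<open>F.ext\<close>, where
    it is immediate on the free algebra, and then passed to the inverse.\<close>
  have "F.ext (weyl_scalar \<kappa> c) = jordan_scalar \<iota> c" for c
    unfolding weyl_scalar_def jordan_scalar_def F.ext_base \<psi>(3) \<epsilon>_abs by (rule refl)
  moreover have "weyl_scalar \<kappa> c \<in> carrier L" for c
    unfolding weyl_scalar_def by (rule l.closed)
  ultimately have "inv_into (carrier L) F.ext (jordan_scalar \<iota> c) = weyl_scalar \<kappa> c" for c
    using inv_into_f_f[OF F.ext_inj] by metis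
  then show ?thesis
    using ring_iso_set_sym[OF FL.Q.ring_axioms iso] by blast
qed

end
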